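(* Let $d\in C^\infty$ be a positive function such that $d$, its derivatives of any order, and $1/d$ are uniformly bounded on the real axis, and let $$H=\frac{\pi^2I^2}{d^2}+\left(\hat p_x-\varepsilon\frac{I\,d'}{d}f(\phi)\right)^2-1,\qquad I>0,$$ where $d,d'$ are evaluated at $X=\varepsilon x$ and $f(\phi)=\phi$ for $\phi\in(0,\pi)$, $f(\phi)=\phi-2\pi$ for $\phi\in(\pi,2\pi)$, extended $2\pi$-periodically. Let $r$ be any prefixed natural number. Then there are functions $S_i(\tilde I,\phi,\tilde p_x,\varepsilon x)$ and $\mathcal H_i(\tilde I,\tilde p_x,\varepsilon\tilde x)$, $1\le i\le r-1$, of class $C^\infty$ with respect to the action, the longitudinal momentum and the slow longitudinal coordinate, with $S_i$ continuous functions of the angle $\phi$, such that after the canonical change of variables $(\hat p_x,x,I,\phi)\mapsto(\tilde p_x,\tilde x,\tilde I,\tilde\phi)$ with generating function $$W=\tilde I\phi+\tilde p_xx+\varepsilon S(\tilde I,\phi,\tilde p_x,\varepsilon x,\varepsilon),\qquad S=S_1+\varepsilon S_2+\dots+\varepsilon^{r-2}S_{r-1},$$ the Hamiltonian takes the form $$H=\mathcal H_{\Sigma,r}(\tilde I,\tilde p_x,\varepsilon\tilde x,\varepsilon)+\varepsilon^rH_r(\tilde I,\phi,\tilde p_x,\varepsilon x,\varepsilon),$$ $$\mathcal H_{\Sigma,r}=\frac{\pi^2\tilde I^2}{d(\varepsilon\tilde x)^2}+\tilde p_x^2-1+\varepsilon\mathcal H_1+\dots+\varepsilon^{r-1}\mathcal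 H_{r-1},$$ where $H_r=O(1)$ as $\varepsilon\to0$.
   Context: The Hamiltonian $H$ describes, between reflections, a ray of light in the planar waveguide $0\le y\le d(\varepsilon x)$ in action-angle variables $(I,\phi)$ for the transversal motion and longitudinal variables $(\hat p_x,x)$ (conjugate pairs); $\varepsilon>0$ is a small parameter, the prime is $d/dX$, $X=\varepsilon x$, and $\phi$ is an angle variable modulo $2\pi$. The change with generating function $W$ is defined by $$I=\tilde I+\varepsilon\frac{\partial S}{\partial\phi},\quad \tilde\phi=\phi+\varepsilon\frac{\partial S}{\partial\tilde I},\quad \hat p_x=\tilde p_x+\varepsilon^2\frac{\partial S}{\partial(\varepsilon x)},\quad \varepsilon\tilde x=\varepsilon x+\varepsilon^2\frac{\partial S}{\partial\tilde p_x}.$$ In the remainder, $\phi$ and $x$ are regarded as functions of the new variables. For $r=1$ the sum $S$ is empty ($S=0$). The change is considered for $\varepsilon$ sufficiently small, with $\tilde I$ in compact subsets of $(0,\infty)$ and $\tilde p_x$ in bounded sets; $O(1)$ is uniform there. *)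

theory Defs
  imports "HOL-Analysis.Analysis"
begin

text \<open>\<open>U\<close> is meant to be an open subset of a finite-dimensional space.\<close>

primrec Ck_on :: "nat \<Rightarrow> 'a::real_normed_vector set \<Rightarrow> ('a \<Rightarrow> 'b::real_normed_vector) \<Rightarrow> bool" where
  "Ck_on 0 U f \<longleftrightarrow> continuous_on U f"
| "Ck_on (Suc k) U f \<longleftrightarrow>
     (\<forall>x\<in>U. f differentiable (at x)) \<and> (\<forall>v. Ck_on k U (\<lambda>x. frechet_derivative f (at x) v))"

definition smooth_on :: "'a::real_normed_vector set \<Rightarrow> ('a \<Rightarrow> 'b::real_normed_vector) \<Rightarrow> bool" where
  "smooth_on U f \<longleftrightarrow> (\<forall>k. Ck_on k U f)"

text \<open>Each derivative has its own bound on the real axis; no bound uniform in the order of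
  differentiation is required.\<close>

definition admissible_profile :: "(real \<Rightarrow> real) \<Rightarrow> bool" where
  "admissible_profile d \<longleftrightarrow>
     (\<forall>X. 0 < d X) \<and>
     (\<forall>k. (deriv ^^ k) d differentiable_on UNIV \<and> bounded (range ((deriv ^^ k) d))) \<and>
     bounded (range (\<lambda>X. 1 / d X))"

text \<open>The \<open>2\<pi>\<close>-periodic function that is the identity on \<open>[-\<pi>, \<pi>)\<close>. Its value at even multiples of
  \<open>\<pi>\<close> is the continuous extension; at odd multiples of \<open>\<pi>\<close> it jumps, and the value there is
  irrelevant because these angles are excluded below.\<close>

definition saw :: "real \<Rightarrow> real" where
  "saw \<phi> = \<phi> - 2 * pi * of_int \<lfloor>(\<phi> + pi) / (2 * pi)\<rfloor>"

lemma saw_lower: "0 < \<phi> \<Longrightarrow> \<phi> < pi \<Longrightarrow> saw \<phi> = \<phi>"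
proof -
  assume "0 < \<phi>" and "\<phi> < pi"
  then have "\<lfloor>(\<phi> + pi) / (2 * pi)\<rfloor> = 0"
    by (simp add: floor_eq_iff field_simps)
  then show ?thesis
    by (simp add: saw_def)
qed

lemma saw_upper: "pi < \<phi> \<Longrightarrow> \<phi> < 2 * pi \<Longrightarrow> saw \<phi> = \<phi> - 2 * pi"
proof -
  assume "pi < \<phi>" and "\<phi> < 2 * pi"
  then have "\<lfloor>(\<phi> + pi) / (2 * pi)\<rfloor> = 1"
    by (simp add: floor_eq_iff field_simps)
  then show ?thesis
    by (simp add: saw_def)
qed

lemma saw_periodic: "saw (\<phi> + 2 * pi) = saw \<phi>"
proof -
  have "(\<phi> + 2 * pi + pi) / (2 * pi) = (\<phi> + pi) / (2 * pi) + of_int 1"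
    by (simp add: field_simps)
  then have "\<lfloor>(\<phi> + 2 * pi + pi) / (2 * pi)\<rfloor> = \<lfloor>(\<phi> + pi) / (2 * pi)\<rfloor> + 1"
    by (metis floor_add_int)
  then show ?thesis
    by (simp add: saw_def algebra_simps)
qed

definition regular_angles :: "real set" where
  "regular_angles = {\<phi>. \<forall>k::int. \<phi> \<noteq> (2 * of_int k + 1) * pi}"

text \<open>Points of the phase space are \<open>(action, angle, momentum, coordinate)\<close>; the angle is
  represented by its lift to the real line.\<close>

type_synonym phase = "real \<times> real \<times> real \<times> real"

definition ham :: "(real \<Rightarrow> real) \<Rightarrow> real \<Rightarrow> phase \<Rightarrow> real" where
  "ham d \<epsilon> = (\<lambda>(I, \<phi>, p, x). let X = \<epsilon> * x in
     pi\<^sup>2 * I\<^sup>2 / (d X)\<^sup>2 + (p - \<epsilon> * (I * deriv d X / d X) * saw \<phi>)\<^sup>2 - 1)"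

definition avg_ham :: "(real \<Rightarrow> real) \<Rightarrow> (nat \<Rightarrow> real \<Rightarrow> real \<Rightarrow> real \<Rightarrow> real) \<Rightarrow> nat \<Rightarrow> real \<Rightarrow> phase \<Rightarrow> real" where
  "avg_ham d h r \<epsilon> = (\<lambda>(J, \<psi>, p, x). let X = \<epsilon> * x in
     pi\<^sup>2 * J\<^sup>2 / (d X)\<^sup>2 + p\<^sup>2 - 1 + (\<Sum>i = 1..r - 1. \<epsilon> ^ i * h i J p X))"

text \<open>A generating function \<open>W J \<phi> p x\<close> depends on the new action \<open>J\<close> and new momentum \<open>p\<close> and on
  the old angle \<open>\<phi>\<close> and old coordinate \<open>x\<close>. The change of variables sends \<open>old_map W z\<close> to
  \<open>new_map W z\<close>, where \<open>z = (J, \<phi>, p, x)\<close> are the mixed variables.\<close>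

type_synonym genfun = "real \<Rightarrow> real \<Rightarrow> real \<Rightarrow> real \<Rightarrow> real"

definition old_map :: "genfun \<Rightarrow> phase \<Rightarrow> phase" where
  "old_map W = (\<lambda>(J, \<phi>, p, x).
     (deriv (\<lambda>\<phi>. W J \<phi> p x) \<phi>, \<phi>, deriv (\<lambda>x. W J \<phi> p x) x, x))"

definition new_map :: "genfun \<Rightarrow> phase \<Rightarrow> phase" where
  "new_map W = (\<lambda>(J, \<phi>, p, x).
     (J, deriv (\<lambda>J. W J \<phi> p x) J, p, deriv (\<lambda>p. W J \<phi> p x) p))"

definition symp :: "phase \<Rightarrow> phase \<Rightarrow> real" where
  "symp = (\<lambda>(a, b, c, e) (a', b', c', e'). a * b' - a' * b + (c * e' - c' * e))"

text \<open>At the mixed point \<open>z\<close> both maps have invertible derivatives \<open>A\<close> and \<open>B\<close>, and the derivative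
  \<open>B \<circ> inv A\<close> of the map from old to new variables preserves the symplectic form.\<close>

definition canonical_at :: "genfun \<Rightarrow> phase \<Rightarrow> bool" where
  "canonical_at W z \<longleftrightarrow> (\<exists>A B.
     (old_map W has_derivative A) (at z) \<and> (new_map W has_derivative B) (at z) \<and>
     bij A \<and> bij B \<and> (\<forall>u v. symp (A u) (A v) = symp (B u) (B v)))"

definition gen_sum :: "(nat \<Rightarrow> genfun) \<Rightarrow> nat \<Rightarrow> real \<Rightarrow> genfun" where
  "gen_sum S r \<epsilon> J \<phi> p X = (\<Sum>i = 1..r - 1. \<epsilon> ^ (i - 1) * S i J \<phi> p X)"

definition gen_W :: "(nat \<Rightarrow> genfun) \<Rightarrow> nat \<Rightarrow> real \<Rightarrow> genfun" where
  "gen_W S r \<epsilon> J \<phi> p x = J * \<phi> + p * x + \<epsilon> * gen_sum S r \<epsilon> J \<phi> p (\<epsilon> * x)"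

text \<open>The defining equations of the change in terms of \<open>gen_sum\<close>.\<close>

lemma old_map_gen_W:
  assumes "(\<lambda>\<phi>. gen_sum S r \<epsilon> J \<phi> p (\<epsilon> * x)) field_differentiable (at \<phi>)"
    and "(\<lambda>X. gen_sum S r \<epsilon> J \<phi> p X) field_differentiable (at (\<epsilon> * x))"
  shows "old_map (gen_W S r \<epsilon>) (J, \<phi>, p, x) =
    (J + \<epsilon> * deriv (\<lambda>\<phi>. gen_sum S r \<epsilon> J \<phi> p (\<epsilon> * x)) \<phi>, \<phi>,
     p + \<epsilon>\<^sup>2 * deriv (\<lambda>X. gen_sum S r \<epsilon> J \<phi> p X) (\<epsilon> * x), x)"
proof -
  let ?G = "gen_sum S r \<epsilon>"
  have 1: "((\<lambda>\<phi>. ?G J \<phi> p (\<epsilon> * x)) has_field_derivative deriv (\<lambda>\<phi>. ?G J \<phi> p (\<epsilon> * x)) \<phi>) (at \<phi>)"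
    using assms(1) by (simp add: DERIV_deriv_iff_field_differentiable)
  have 2: "((\<lambda>X. ?G J \<phi> p X) has_field_derivative deriv (\<lambda>X. ?G J \<phi> p X) (\<epsilon> * x)) (at (\<epsilon> * x))"
    using assms(2) by (simp add: DERIV_deriv_iff_field_differentiable)
  have 3: "((\<lambda>x. ?G J \<phi> p (\<epsilon> * x)) has_field_derivative deriv (\<lambda>X. ?G J \<phi> p X) (\<epsilon> * x) * \<epsilon>) (at x)"
    by (rule DERIV_chain2[where g = "\<lambda>x. \<epsilon> * x", OF 2]) (auto intro!: derivative_eq_intros)
  have "((\<lambda>\<phi>. gen_W S r \<epsilon> J \<phi> p x) has_field_derivative
      J + \<epsilon> * deriv (\<lambda>\<phi>. ?G J \<phi> p (\<epsilon> * x)) \<phi>) (at \<phi>)"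
    unfolding gen_W_def by (auto intro!: derivative_eq_intros 1)
  moreover have "((\<lambda>x. gen_W S r \<epsilon> J \<phi> p x) has_field_derivative
      p + \<epsilon>\<^sup>2 * deriv (\<lambda>X. ?G J \<phi> p X) (\<epsilon> * x)) (at x)"
    unfolding gen_W_def by (auto intro!: derivative_eq_intros 3 simp: power2_eq_square)
  ultimately show ?thesis
    by (simp add: old_map_def DERIV_imp_deriv)
qed

lemma new_map_gen_W:
  assumes "(\<lambda>J. gen_sum S r \<epsilon> J \<phi> p (\<epsilon> * x)) field_differentiable (at J)"
    and "(\<lambda>p. gen_sum S r \<epsilon> J \<phi> p (\<epsilon> * x)) field_differentiable (at p)"
  shows "new_map (gen_W S r \<epsilon>) (J, \<phi>, p, x) =
    (J, \<phi> + \<epsilon> * deriv (\<lambda>J. gen_sum S r \<epsilon> J \<phi> p (\<epsilon> * x)) J,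
     p, x + \<epsilon> * deriv (\<lambda>p. gen_sum S r \<epsilon> J \<phi> p (\<epsilon> * x)) p)"
proof -
  let ?G = "gen_sum S r \<epsilon>"
  have 1: "((\<lambda>J. ?G J \<phi> p (\<epsilon> * x)) has_field_derivative deriv (\<lambda>J. ?G J \<phi> p (\<epsilon> * x)) J) (at J)"
    using assms(1) by (simp add: DERIV_deriv_iff_field_differentiable)
  have 2: "((\<lambda>p. ?G J \<phi> p (\<epsilon> * x)) has_field_derivative deriv (\<lambda>p. ?G J \<phi> p (\<epsilon> * x)) p) (at p)"
    using assms(2) by (simp add: DERIV_deriv_iff_field_differentiable)
  have "((\<lambda>J. gen_W S r \<epsilon> J \<phi> p x) has_field_derivative
      \<phi> + \<epsilon> * deriv (\<lambda>J. ?G J \<phi> p (\<epsilon> * x)) J) (at J)"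
    unfolding gen_W_def by (auto intro!: derivative_eq_intros 1)
  moreover have "((\<lambda>p. gen_W S r \<epsilon> J \<phi> p x) has_field_derivative
      x + \<epsilon> * deriv (\<lambda>p. ?G J \<phi> p (\<epsilon> * x)) p) (at p)"
    unfolding gen_W_def by (auto intro!: derivative_eq_intros 2)
  ultimately show ?thesis
    by (simp add: new_map_def DERIV_imp_deriv)
qed

text \<open>The change generated by \<open>W\<close> is well defined for new actions in \<open>K\<close> and new momenta in \<open>B\<close>.
  The new variables determine the mixed ones uniquely (\<open>bij_betw\<close>); away from the jumps of
  \<^const>\<open>saw\<close>, where \<open>\<partial>W/\<partial>\<phi>\<close> need not exist, old and new variables determine each other and the
  correspondence is canonical.\<close>

definition canonical_change_on :: "genfun \<Rightarrow> real set \<Rightarrow> real set \<Rightarrow> bool" where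
  "canonical_change_on W K B \<longleftrightarrow>
     bij_betw (new_map W) (K \<times> UNIV \<times> B \<times> UNIV) (K \<times> UNIV \<times> B \<times> UNIV) \<and>
     inj_on (old_map W) (K \<times> regular_angles \<times> B \<times> UNIV) \<and>
     (\<forall>z \<in> K \<times> regular_angles \<times> B \<times> UNIV. 0 < fst (old_map W z) \<and> canonical_at W z)"

end

theory Submission
  imports Defs
begin

text \<open>At order \<open>\<epsilon>\<^sup>i\<close> the normal form leads to the equation
  \<open>(2\<pi>\<^sup>2J / d\<^sup>2) \<partial>S\<^sub>i/\<partial>\<phi> + a\<^sub>i = h\<^sub>i\<close>, where \<open>a\<^sub>i\<close> is known once the lower orders are. It is
  solved by taking for \<open>h\<^sub>i\<close> the mean of \<open>a\<^sub>i\<close> over the angle and for \<open>S\<^sub>i\<close> a primitive of the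
  rest (\<open>homological_equation\<close>).

  The discontinuity of the saw-tooth function does not obstruct this. All functions that occur are
  polynomials in \<open>s = saw \<phi>\<close> with coefficients generated by \<open>J\<close>, \<open>1/J\<close>, \<open>p\<close>, the derivatives of
  \<open>d\<close> and \<open>1/d\<close>. Treating \<open>s\<close> as an independent variable, they form a ring (\<open>coeffs\<close>) closed under
  partial derivatives (\<open>D_coeffs\<close>) and under integration in \<open>s\<close> (\<open>angle_antiderivative\<close>), and each
  element is bounded uniformly in \<open>X\<close> over compact sets of the other variables
  with \<open>J > 0\<close> (\<open>coeffs_bounded\<close>). As the integrand has mean zero over \<open>[-\<pi>, \<pi>]\<close>, the function
  \<open>S\<^sub>i\<close> takes equal values at \<open>s = -\<pi>\<close> and \<open>s = \<pi>\<close>; this is exactly continuity of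
  \<open>\<phi> \<mapsto> S\<^sub>i(J, saw \<phi>, p, X)\<close> across the jump.

  The functions \<open>a\<^sub>i\<close> are never computed. The difference between the transformed
  Hamiltonian and the candidate normal form (\<open>defect\<close>) has an asymptotic expansion in \<open>\<epsilon>\<close> with
  coefficients in the ring (\<open>expands_defect\<close>); the displaced argument \<open>X + \<epsilon>\<^sup>2 \<partial>S/\<partial>p\<close> is handled by
  Taylor's formula (\<open>expands_shift\<close>). If the defect is of order \<open>n + 1\<close>, then its term of
  that order can be read off (\<open>expands_leading_term\<close>), and adding the next \<open>S\<close> and \<open>h\<close>
  turns the coefficient of \<open>\<epsilon>^(n+1)\<close> into the difference of the two sides of the homological equation
  and otherwise has only an effect of higher order (\<open>defect_step\<close>). Induction gives \<open>normal_form\<close>.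

  For the change of variables, \<open>g = S\<^sub>1 + \<epsilon> S\<^sub>2 + \<dots>\<close> has first and second derivatives bounded
  uniformly in small \<open>\<epsilon>\<close>. The derivatives \<open>\<partial>g/\<partial>J\<close> and \<open>\<partial>g/\<partial>p\<close> inherit from \<open>g\<close> the matching of
  values at \<open>s = \<plusminus>\<pi>\<close>, so that they are Lipschitz functions of all real \<open>\<phi>\<close>; hence the map to the new
  variables is an \<open>\<epsilon>\<close>-small Lipschitz perturbation of the identity in \<open>(\<phi>, x)\<close> and bijective by
  contraction. The same smallness gives injectivity of the map to the old variables and
  invertibility of both differentials. The symplectic identity reduces to the symmetry of
  the second derivatives of \<open>g\<close> (\<open>D_commute\<close>).\<close>

section \<open>Directional derivatives on the half space of positive actions\<close>

definition D :: "phase \<Rightarrow> (phase \<Rightarrow> real) \<Rightarrow> phase \<Rightarrow> real" where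
  "D v u z = frechet_derivative u (at z) v"

abbreviation e_action :: phase where "e_action \<equiv> (1, 0, 0, 0)"
abbreviation e_angle :: phase where "e_angle \<equiv> (0, 1, 0, 0)"
abbreviation e_momentum :: phase where "e_momentum \<equiv> (0, 0, 1, 0)"
abbreviation e_coord :: phase where "e_coord \<equiv> (0, 0, 0, 1)"

lemma open_positive_action: "open {z::phase. 0 < fst z}"
  by (intro open_Collect_less continuous_intros)

lemma D_eqI: "(u has_derivative u') (at z) \<Longrightarrow> D v u z = u' v"
  by (metis D_def frechet_derivative_at)

lemma has_derivative_D: "u differentiable (at z) \<Longrightarrow> (u has_derivative (\<lambda>v. D v u z)) (at z)"
  unfolding D_def using frechet_derivative_works by fastforce

lemma has_derivative_positive_action_cong:
  fixes u w :: "phase \<Rightarrow> real"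
  assumes "(u has_derivative u') (at z)" "\<And>z. 0 < fst z \<Longrightarrow> w z = u z" "0 < fst z"
  shows "(w has_derivative u') (at z)"
  using has_derivative_transform_within_open[of u u' z UNIV, OF _ open_positive_action] assms
  by auto

text \<open>Coefficient functions matter only where the action is positive: \<open>1/J\<close> has no derivative at
  \<open>J = 0\<close>. Since this region is open, derivatives there ignore the values elsewhere.\<close>

lemma D_cong:
  assumes "\<And>z. 0 < fst z \<Longrightarrow> w z = u z" "0 < fst z"
  shows "D v w z = D v u z"
proof -
  have "(w has_derivative u') (at z) \<longleftrightarrow> (u has_derivative u') (at z)" for u'
    using has_derivative_positive_action_cong assms by metis
  then show ?thesis
    unfolding D_def frechet_derivative_def by simp
qed

lemma D_add:
  assumes "u differentiable (at z)" "w differentiable (at z)"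
  shows "D v (\<lambda>z. u z + w z) z = D v u z + D v w z"
  using D_eqI[OF has_derivative_add[OF has_derivative_D has_derivative_D]] assms by simp

lemma D_mult:
  assumes "u differentiable (at z)" "w differentiable (at z)"
  shows "D v (\<lambda>z. u z * w z) z = u z * D v w z + D v u z * w z"
  using D_eqI[OF has_derivative_mult[OF has_derivative_D has_derivative_D]] assms by simp

lemma D_const [simp]: "D v (\<lambda>z. c) z = 0"
  by (rule D_eqI) simp

section \<open>The ring of coefficient functions\<close>

lemma has_derivative_coord:
  assumes "(f has_field_derivative f') (at (snd (snd (snd z))))"
  shows "((\<lambda>(J, s, p, X). f X) has_derivative (\<lambda>v. f' * snd (snd (snd v)))) (at (z::phase))"
proof -
  have "((\<lambda>z::phase. snd (snd (snd z))) has_derivative (\<lambda>v. snd (snd (snd v)))) (at z)"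
    by (auto intro!: derivative_eq_intros)
  from has_derivative_compose[OF this has_field_derivative_imp_has_derivative[OF assms]]
  show ?thesis
    by (simp add: case_prod_beta')
qed

locale waveguide =
  fixes d :: "real \<Rightarrow> real"
  assumes profile: "admissible_profile d"
begin

lemma d_pos: "0 < d X"
  using profile by (simp add: admissible_profile_def)

lemma d_nonzero [simp]: "d X \<noteq> 0"
  using d_pos[of X] by simp

lemma deriv_iter_d: "((deriv ^^ k) d has_field_derivative (deriv ^^ Suc k) d X) (at X)"
proof -
  have "(deriv ^^ k) d differentiable (at X)"
    using profile by (simp add: admissible_profile_def differentiable_on_def)
  then show ?thesis
    by (simp add: DERIV_deriv_iff_real_differentiable)
qed

text \<open>The second component \<open>s\<close> stands for \<^term>\<open>saw \<phi>\<close> but is treated as an independent real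
  variable. Inverse powers of the action arise from solving the homological equation. The rule
  \<open>agree\<close> identifies functions that coincide for positive action; without it the set need not be
  closed under \<^const>\<open>D\<close>, because the derivative of \<open>1/J\<close> at \<open>J = 0\<close> is arbitrary.\<close>

inductive_set coeffs :: "(phase \<Rightarrow> real) set" where
  const: "(\<lambda>z. c) \<in> coeffs"
| action: "(\<lambda>(J, s, p, X). J) \<in> coeffs"
| inv_action: "(\<lambda>(J, s, p, X). inverse J) \<in> coeffs"
| angle: "(\<lambda>(J, s, p, X). s) \<in> coeffs"
| momentum: "(\<lambda>(J, s, p, X). p) \<in> coeffs"
| profile_deriv: "(\<lambda>(J, s, p, X). (deriv ^^ k) d X) \<in> coeffs"
| inv_profile: "(\<lambda>(J, s, p, X). inverse (d X)) \<in> coeffs"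
| add: "u \<in> coeffs \<Longrightarrow> w \<in> coeffs \<Longrightarrow> (\<lambda>z. u z + w z) \<in> coeffs"
| mult: "u \<in> coeffs \<Longrightarrow> w \<in> coeffs \<Longrightarrow> (\<lambda>z. u z * w z) \<in> coeffs"
| agree: "u \<in> coeffs \<Longrightarrow> (\<And>z. 0 < fst z \<Longrightarrow> w z = u z) \<Longrightarrow> w \<in> coeffs"

lemma has_derivative_profile:
  "((\<lambda>(J, s, p, X). (deriv ^^ k) d X) has_derivative
     (\<lambda>v. (deriv ^^ Suc k) d (snd (snd (snd z))) * snd (snd (snd v)))) (at (z::phase))"
  by (intro has_derivative_coord deriv_iter_d)

lemma has_derivative_inv_profile:
  "((\<lambda>(J, s, p, X). inverse (d X)) has_derivative
     (\<lambda>v. - (inverse (d (snd (snd (snd z)))))\<^sup>2 * (deriv ^^ 1) d (snd (snd (snd z))) * snd (snd (snd v)))) (at (z::phase))"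
  by (intro has_derivative_coord) (use deriv_iter_d[of 0] in \<open>auto intro!: derivative_eq_intros simp: power2_eq_square\<close>)

lemma has_derivative_inv_action:
  "0 < fst z \<Longrightarrow> ((\<lambda>(J, s, p, X). inverse J) has_derivative
     (\<lambda>v. - (inverse (fst z))\<^sup>2 * fst v)) (at z :: phase filter)"
  unfolding case_prod_beta'
  by (auto intro!: derivative_eq_intros simp: power2_eq_square)

lemma has_derivative_action: "((\<lambda>(J, s, p, X). J) has_derivative (\<lambda>v. fst v)) (at (z::phase))"
  and has_derivative_angle: "((\<lambda>(J, s, p, X). s) has_derivative (\<lambda>v. fst (snd v))) (at (z::phase))"
  and has_derivative_momentum:
    "((\<lambda>(J, s, p, X). p) has_derivative (\<lambda>v. fst (snd (snd v)))) (at (z::phase))"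
  unfolding case_prod_beta' by (auto intro!: derivative_eq_intros)

lemma coeffs_differentiable: "u \<in> coeffs \<Longrightarrow> 0 < fst z \<Longrightarrow> u differentiable (at z)"
proof (induction rule: coeffs.induct)
  case (agree u w)
  then show ?case
    using has_derivative_positive_action_cong unfolding differentiable_def by metis
qed (auto intro: differentiableI[OF has_derivative_profile] differentiableI[OF has_derivative_inv_profile]
      differentiableI[OF has_derivative_inv_action] differentiableI[OF has_derivative_action]
      differentiableI[OF has_derivative_angle] differentiableI[OF has_derivative_momentum]
      simp del: One_nat_def)

lemmas D_generators =
  D_eqI[OF has_derivative_profile] D_eqI[OF has_derivative_inv_profile]
  D_eqI[OF has_derivative_inv_action] D_eqI[OF has_derivative_action]
  D_eqI[OF has_derivative_angle] D_eqI[OF has_derivative_momentum]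

lemma coeffs_has_derivative:
  "u \<in> coeffs \<Longrightarrow> 0 < fst z \<Longrightarrow> (u has_derivative (\<lambda>v. D v u z)) (at z)"
  by (intro has_derivative_D coeffs_differentiable)

lemma D_coeffs: "u \<in> coeffs \<Longrightarrow> D v u \<in> coeffs"
proof (induction rule: coeffs.induct)
  case (const c)
  show ?case
    by (rule coeffs.agree[OF coeffs.const[of 0]]) simp
next
  case action
  show ?case
    by (rule coeffs.agree[OF coeffs.const[of "fst v"]]) (simp add: D_generators)
next
  case inv_action
  show ?case
    by (rule coeffs.agree[OF coeffs.mult[OF coeffs.const[of "- fst v"]
          coeffs.mult[OF coeffs.inv_action coeffs.inv_action]]])
      (subst D_generators, assumption, simp add: power2_eq_square case_prod_beta)
next
  case angle
  show ?case
    by (rule coeffs.agree[OF coeffs.const[of "fst (snd v)"]]) (simp add: D_generators)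
next
  case momentum
  show ?case
    by (rule coeffs.agree[OF coeffs.const[of "fst (snd (snd v))"]]) (simp add: D_generators)
next
  case (profile_deriv k)
  show ?case
    by (rule coeffs.agree[OF coeffs.mult[OF coeffs.profile_deriv[of "Suc k"]
          coeffs.const[of "snd (snd (snd v))"]]]) (subst D_generators, simp add: case_prod_beta)
next
  case inv_profile
  show ?case
    by (rule coeffs.agree[OF coeffs.mult[OF coeffs.const[of "- snd (snd (snd v))"]
          coeffs.mult[OF coeffs.profile_deriv[of 1]
          coeffs.mult[OF coeffs.inv_profile coeffs.inv_profile]]]])
      (subst D_generators, simp add: power2_eq_square case_prod_beta)
next
  case (add u w)
  show ?case
    by (rule coeffs.agree[OF coeffs.add[OF add.IH]])
      (simp add: D_add coeffs_differentiable add.hyps)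
next
  case (mult u w)
  show ?case
    by (rule coeffs.agree[OF coeffs.add[OF coeffs.mult[OF mult.hyps(1) mult.IH(2)]
          coeffs.mult[OF mult.IH(1) mult.hyps(2)]]])
      (simp add: D_mult coeffs_differentiable mult.hyps)
next
  case (agree u w)
  show ?case
    by (rule coeffs.agree[OF agree.IH]) (rule D_cong[OF agree.hyps(2)])
qed

lemma D_linear:
  assumes "u \<in> coeffs" "0 < fst z"
  shows "D (a, b, c, e) u z =
    a * D e_action u z + b * D e_angle u z + c * D e_momentum u z + e * D e_coord u z"
proof -
  interpret linear "\<lambda>v. D v u z"
    using coeffs_has_derivative[OF assms] by (rule has_derivative_linear)
  have "(a, b, c, e) = a *\<^sub>R e_action + b *\<^sub>R e_angle + c *\<^sub>R e_momentum + e *\<^sub>R e_coord"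
    by simp
  then show ?thesis
    by (simp only: add scaleR real_scaleR_def)
qed

text \<open>Symmetry of second derivatives follows by induction over the ring operations: on generators both
  sides are explicit, and the product rule preserves the symmetry. It is all that the symplectic
  identity rests on.\<close>

lemma D_commute: "u \<in> coeffs \<Longrightarrow> 0 < fst z \<Longrightarrow> D a (D b u) z = D b (D a u) z"
proof (induction arbitrary: a b z rule: coeffs.induct)
  case (const c)
  have "D v (\<lambda>z. c) = (\<lambda>z. 0)" for v by (rule ext) simp
  then show ?case by simp
next
  case action
  have "D v (\<lambda>(J, s, p, X). J) = (\<lambda>z. fst v)" for v by (rule ext) (simp add: D_generators)
  then show ?case by simp
next
  case angle
  have "D v (\<lambda>(J, s, p, X). s) = (\<lambda>z. fst (snd v))" for v by (rule ext) (simp add: D_generators)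
  then show ?case by simp
next
  case momentum
  have "D v (\<lambda>(J, s, p, X). p) = (\<lambda>z. fst (snd (snd v)))" for v
    by (rule ext) (simp add: D_generators)
  then show ?case by simp
next
  case inv_action
  let ?q = "\<lambda>z::phase. (inverse (fst z))\<^sup>2"
  have q: "(?q has_derivative (\<lambda>v. - 2 * (inverse (fst z)) ^ 3 * fst v)) (at z)"
    using inv_action
    by (auto intro!: derivative_eq_intros simp: power2_eq_square power3_eq_cube)
  have "D v (D w (\<lambda>(J, s, p, X). inverse J)) z = - 2 * (inverse (fst z)) ^ 3 * fst v * (- fst w)" for v w
  proof -
    have "D v (D w (\<lambda>(J, s, p, X). inverse J)) z = D v (\<lambda>z. ?q z * (- fst w)) z"
      by (rule D_cong) (subst D_generators, auto simp: inv_action)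
    also have "\<dots> = D v ?q z * (- fst w)"
      using differentiableI[OF q] by (subst D_mult) auto
    finally show ?thesis
      by (simp only: D_eqI[OF q])
  qed
  then show ?case
    by simp
next
  case (profile_deriv k)
  have "D w (\<lambda>(J, s, p, X). (deriv ^^ k) d X) =
      (\<lambda>z. (\<lambda>(J, s, p, X). (deriv ^^ Suc k) d X) z * snd (snd (snd w)))" for w
    by (rule ext) (auto simp: D_generators)
  then have "D v (D w (\<lambda>(J, s, p, X). (deriv ^^ k) d X)) z =
      D v (\<lambda>(J, s, p, X). (deriv ^^ Suc k) d X) z * snd (snd (snd w))" for v w
    using coeffs_differentiable[OF coeffs.profile_deriv[of "Suc k"] profile_deriv]
    by (simp add: D_mult)
  then show ?case
    by (simp only: D_generators(1)[of _ "Suc k"] mult.assoc mult.commute[of "snd (snd (snd a))"])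
next
  case inv_profile
  let ?q = "\<lambda>X. (deriv ^^ 1) d X * (inverse (d X) * inverse (d X))"
  have eq: "D w (\<lambda>(J, s, p, X). inverse (d X)) =
      (\<lambda>z. (\<lambda>(J, s, p, X). ?q X) z * (- snd (snd (snd w))))" for w
    by (rule ext) (auto simp: D_generators power2_eq_square)
  obtain q' where q': "(?q has_field_derivative q') (at (snd (snd (snd z))))"
    using deriv_iter_d[of 0] deriv_iter_d[of 1] by (auto intro!: derivative_eq_intros that)
  note q = has_derivative_coord[OF q']
  have "D v (D w (\<lambda>(J, s, p, X). inverse (d X))) z =
      D v (\<lambda>(J, s, p, X). ?q X) z * (- snd (snd (snd w)))" for v w
    unfolding eq by (subst D_mult[OF differentiableI[OF q] differentiable_const]) simp
  then show ?case
    by (simp only: D_eqI[OF q] mult.assoc mult.commute[of "snd (snd (snd a))"] mult_minus_right)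
next
  case (add u w)
  have "D a (D b (\<lambda>z. u z + w z)) z = D a (D b u) z + D a (D b w) z" for a b
  proof -
    have "D a (D b (\<lambda>z. u z + w z)) z = D a (\<lambda>z. D b u z + D b w z) z"
      using add by (intro D_cong D_add coeffs_differentiable)
    then show ?thesis
      using add by (simp add: D_add coeffs_differentiable D_coeffs)
  qed
  then show ?case
    using add by simp
next
  case (mult u w)
  have "D a (D b (\<lambda>z. u z * w z)) z =
      u z * D a (D b w) z + D a u z * D b w z + (D b u z * D a w z + D a (D b u) z * w z)" for a b
  proof -
    have "D a (D b (\<lambda>z. u z * w z)) z = D a (\<lambda>z. u z * D b w z + D b u z * w z) z"
      using mult by (intro D_cong D_mult coeffs_differentiable)
    then show ?thesis
      using mult by (simp add: D_add D_mult coeffs_differentiable D_coeffs)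
  qed
  then show ?case
    using mult by simp
next
  case (agree u w)
  have "D a (D b w) z = D a (D b u) z" for a b
    using agree by (intro D_cong)
  then show ?case
    using agree by simp
qed

end

text \<open>The regions over which all estimates are uniform. They exhaust the phase space with positive
  action, reduced to one period of the angle, and do not restrict the coordinate.\<close>

definition phase_box :: "real \<Rightarrow> phase set" where
  "phase_box m = {inverse m..m} \<times> {-pi..pi} \<times> {-m..m} \<times> UNIV"

lemma box_positive_action: "0 < m \<Longrightarrow> z \<in> phase_box m \<Longrightarrow> 0 < fst z"
  by (auto simp: phase_box_def intro: less_le_trans[of 0 "inverse m"])

context waveguide
begin

lemma coeffs_power: "u \<in> coeffs \<Longrightarrow> (\<lambda>z. u z ^ n) \<in> coeffs"
  by (induction n) (auto intro: coeffs.intros)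

lemma coeffs_minus: "u \<in> coeffs \<Longrightarrow> (\<lambda>z. - u z) \<in> coeffs"
  using coeffs.mult[OF coeffs.const[of "-1"]] by simp

lemma coeffs_diff: "u \<in> coeffs \<Longrightarrow> w \<in> coeffs \<Longrightarrow> (\<lambda>z. u z - w z) \<in> coeffs"
  using coeffs.add[OF _ coeffs_minus] by simp

lemma coeffs_sum: "(\<And>i. i \<in> A \<Longrightarrow> u i \<in> coeffs) \<Longrightarrow> (\<lambda>z. \<Sum>i\<in>A. u i z) \<in> coeffs"
  by (induction A rule: infinite_finite_induct) (auto intro: coeffs.intros)

lemmas coeffs_intros = coeffs.const coeffs.action coeffs.inv_action coeffs.angle coeffs.momentum
  coeffs.profile_deriv coeffs.inv_profile coeffs.add coeffs.mult coeffs_power coeffs_minus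
  coeffs_diff coeffs_sum D_coeffs

text \<open>Uniformity in \<open>X\<close> comes from the boundedness of \<open>1/d\<close> and of every derivative of \<open>d\<close>.\<close>

lemma coeffs_bounded:
  assumes "u \<in> coeffs" "0 < m"
  shows "\<exists>C>0. \<forall>z\<in>phase_box m. \<bar>u z\<bar> \<le> C"
  using assms(1)
proof (induction rule: coeffs.induct)
  case (const c)
  show ?case by (rule exI[of _ "\<bar>c\<bar> + 1"]) auto
next
  case action
  have "\<bar>J\<bar> \<le> m" if "(J, s, p, X) \<in> phase_box m" for J s p X
    using that box_positive_action[OF \<open>0 < m\<close> that] by (simp add: phase_box_def)
  then show ?case using \<open>0 < m\<close> by auto
next
  case inv_action
  have "\<bar>inverse J\<bar> \<le> m" if "(J, s, p, X) \<in> phase_box m" for J s p X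
    using that box_positive_action[OF \<open>0 < m\<close> that] \<open>0 < m\<close>
      le_imp_inverse_le[of "inverse m" J] by (simp add: phase_box_def)
  then show ?case using \<open>0 < m\<close> by auto
next
  case angle
  show ?case by (intro exI[of _ pi]) (auto simp: phase_box_def)
next
  case momentum
  show ?case using \<open>0 < m\<close> by (intro exI[of _ m]) (auto simp: phase_box_def)
next
  case (profile_deriv k)
  have "bounded (range ((deriv ^^ k) d))"
    using profile by (simp add: admissible_profile_def)
  then obtain C where "C > 0" "\<And>X. \<bar>(deriv ^^ k) d X\<bar> \<le> C"
    by (auto simp: bounded_pos)
  then show ?case by (intro exI[of _ C]) auto
next
  case inv_profile
  have "bounded (range (\<lambda>X. 1 / d X))"
    using profile by (simp add: admissible_profile_def)
  then obtain C where "C > 0" "\<And>X. \<bar>inverse (d X)\<bar> \<le> C"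
    by (auto simp: bounded_pos divide_inverse)
  then show ?case by (intro exI[of _ C]) auto
next
  case (add u w)
  then obtain C C' where C: "C > 0" "C' > 0" "\<And>z. z \<in> phase_box m \<Longrightarrow> \<bar>u z\<bar> \<le> C"
    "\<And>z. z \<in> phase_box m \<Longrightarrow> \<bar>w z\<bar> \<le> C'" by blast
  have "\<bar>u z + w z\<bar> \<le> C + C'" if "z \<in> phase_box m" for z
    using C(3,4)[OF that] by linarith
  then show ?case using C(1,2) by (intro exI[of _ "C + C'"]) simp
next
  case (mult u w)
  then obtain C C' where C: "C > 0" "C' > 0" "\<And>z. z \<in> phase_box m \<Longrightarrow> \<bar>u z\<bar> \<le> C"
    "\<And>z. z \<in> phase_box m \<Longrightarrow> \<bar>w z\<bar> \<le> C'" by blast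
  have "\<bar>u z * w z\<bar> \<le> C * C'" if "z \<in> phase_box m" for z
    using C(3,4)[OF that] C(1) by (simp add: abs_mult mult_mono)
  then show ?case using C(1,2) by (intro exI[of _ "C * C'"]) simp
next
  case (agree u w)
  then show ?case using box_positive_action[OF \<open>0 < m\<close>] by metis
qed

lemma coeffs_at_angle: "u \<in> coeffs \<Longrightarrow> (\<lambda>(J, s, p, X). u (J, t, p, X)) \<in> coeffs"
proof (induction rule: coeffs.induct)
  case (add u w)
  show ?case using coeffs.add[OF add.IH] by (simp add: case_prod_beta')
next
  case (mult u w)
  show ?case using coeffs.mult[OF mult.IH] by (simp add: case_prod_beta')
next
  case (agree u w)
  show ?case by (rule coeffs.agree[OF agree.IH]) (use agree.hyps in auto)
next
  case (const c)
  show ?case by (rule coeffs.agree[OF coeffs.const]) auto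
next
  case angle
  show ?case by (rule coeffs.agree[OF coeffs.const[of t]]) auto
next
  case action
  show ?case by (rule coeffs.agree[OF coeffs.action]) auto
next
  case inv_action
  show ?case by (rule coeffs.agree[OF coeffs.inv_action]) auto
next
  case momentum
  show ?case by (rule coeffs.agree[OF coeffs.momentum]) auto
next
  case (profile_deriv k)
  show ?case by (rule coeffs.agree[OF coeffs.profile_deriv]) auto
next
  case inv_profile
  show ?case by (rule coeffs.agree[OF coeffs.inv_profile]) auto
qed

section \<open>Partial derivatives and smoothness\<close>

lemma D_path:
  assumes "u \<in> coeffs" "0 < fst (\<gamma> t)" "(\<gamma> has_derivative (\<lambda>h. h *\<^sub>R v)) (at t)"
  shows "((\<lambda>t. u (\<gamma> t)) has_field_derivative D v u (\<gamma> t)) (at t)"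
proof -
  interpret linear "\<lambda>v. D v u (\<gamma> t)"
    using coeffs_has_derivative[OF assms(1,2)] by (rule has_derivative_linear)
  show ?thesis
    using has_derivative_compose[OF assms(3) coeffs_has_derivative[OF assms(1,2)]]
    by (simp add: scaleR has_field_derivative_def mult_commute_abs)
qed

lemma coeffs_partial:
  assumes "u \<in> coeffs" "0 < J"
  shows "((\<lambda>J. u (J, s, p, X)) has_field_derivative D e_action u (J, s, p, X)) (at J)"
    and "((\<lambda>s. u (J, s, p, X)) has_field_derivative D e_angle u (J, s, p, X)) (at s)"
    and "((\<lambda>p. u (J, s, p, X)) has_field_derivative D e_momentum u (J, s, p, X)) (at p)"
    and "((\<lambda>X. u (J, s, p, X)) has_field_derivative D e_coord u (J, s, p, X)) (at X)"
  using assms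
  by (auto intro!: D_path derivative_eq_intros simp: fun_eq_iff zero_prod_def)

lemma Ck_on_cong:
  assumes "open U" "\<And>x. x \<in> U \<Longrightarrow> f x = g x" "Ck_on k U g"
  shows "Ck_on k U f"
  using assms(2,3)
proof (induction k arbitrary: f g)
  case 0
  then show ?case using continuous_on_cong[of U U f g] by simp
next
  case (Suc k)
  have tr: "(f has_derivative f') (at x) \<longleftrightarrow> (g has_derivative f') (at x)" if "x \<in> U" for x f'
    using that Suc.prems(1) \<open>open U\<close>
      has_derivative_transform_within_open[of f f' x UNIV U g]
      has_derivative_transform_within_open[of g f' x UNIV U f] by auto
  have "f differentiable (at x)" if "x \<in> U" for x
    using Suc.prems(2) that by (auto simp: differentiable_def tr)
  moreover have "Ck_on k U (\<lambda>x. frechet_derivative f (at x) v)" for v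
  proof (rule Suc.IH)
    show "frechet_derivative f (at x) v = frechet_derivative g (at x) v" if "x \<in> U" for x
      using that by (simp add: frechet_derivative_def tr)
    show "Ck_on k U (\<lambda>x. frechet_derivative g (at x) v)"
      using Suc.prems(2) by simp
  qed
  ultimately show ?case by simp
qed

text \<open>By \<open>D_coeffs\<close> every directional derivative is again a coefficient function, so differentiability
  of coefficient functions already yields all orders.\<close>

lemma coeffs_smooth_on:
  assumes "u \<in> coeffs"
  shows "smooth_on ({0<..} \<times> UNIV \<times> UNIV) (\<lambda>(J, p, X). u (J, s, p, X))"
  unfolding smooth_on_def
proof
  fix k
  let ?U = "{0<..} \<times> UNIV \<times> (UNIV :: real set) :: (real \<times> real \<times> real) set"
  have der: "((\<lambda>(J, p, X). u (J, s, p, X)) has_derivative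
      (\<lambda>(a, c, e). D (a, 0, c, e) u (fst x, s, snd x))) (at x)"
    if "u \<in> coeffs" "x \<in> ?U" for u x
  proof -
    have "((\<lambda>x. (fst x, s, snd x)) has_derivative (\<lambda>v. (fst v, 0, snd v))) (at x)"
      by (auto intro!: derivative_eq_intros)
    from has_derivative_compose[OF this coeffs_has_derivative[OF that(1)]] that(2)
    show ?thesis by (simp add: case_prod_beta' mem_Times_iff)
  qed
  have op: "open ?U"
    by (intro open_Times) auto
  show "Ck_on k ?U (\<lambda>(J, p, X). u (J, s, p, X))"
    using assms
  proof (induction k arbitrary: u)
    case 0
    then show ?case
      unfolding Ck_on.simps
      by (intro continuous_at_imp_continuous_on ballI has_derivative_continuous[OF der])
  next
    case (Suc k)
    have "Ck_on k ?U (\<lambda>x. frechet_derivative (\<lambda>(J, p, X). u (J, s, p, X)) (at x) v)" for v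
    proof -
      obtain a c e where v: "v = (a, c, e)" by (cases v)
      show ?thesis
      proof (rule Ck_on_cong[OF op])
      show "Ck_on k ?U (\<lambda>(J, p, X). D (a, 0, c, e) u (J, s, p, X))"
        by (rule Suc.IH[OF D_coeffs[OF Suc.prems]])
      show "frechet_derivative (\<lambda>(J, p, X). u (J, s, p, X)) (at x) v =
          (\<lambda>(J, p, X). D (a, 0, c, e) u (J, s, p, X)) x" if "x \<in> ?U" for x
        using frechet_derivative_at[OF der[OF Suc.prems that]] v by (cases x) (simp add: fun_eq_iff)
      qed
    qed
    then show ?case
      unfolding Ck_on.simps using differentiableI[OF der[OF Suc.prems]] by blast
  qed
qed

section \<open>Integration over the angle\<close>

definition angle_free :: "(phase \<Rightarrow> real) \<Rightarrow> bool" where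
  "angle_free u \<longleftrightarrow> (\<forall>J s s' p X. 0 < J \<longrightarrow> u (J, s, p, X) = u (J, s', p, X))"

text \<open>Integration in \<open>s\<close> has no product rule, so the ring is rewritten as sums of monomials in \<open>s\<close>,
  which can be integrated one at a time.\<close>

inductive_set angle_polys :: "(phase \<Rightarrow> real) set" where
  monomial: "c \<in> coeffs \<Longrightarrow> angle_free c \<Longrightarrow> (\<And>z. 0 < fst z \<Longrightarrow> u z = c z * fst (snd z) ^ k) \<Longrightarrow>
    u \<in> angle_polys"
| sum: "u \<in> angle_polys \<Longrightarrow> w \<in> angle_polys \<Longrightarrow> (\<And>z. 0 < fst z \<Longrightarrow> v z = u z + w z) \<Longrightarrow>
    v \<in> angle_polys"

lemma angle_polys_agree:
  assumes "u \<in> angle_polys" "\<And>z. 0 < fst z \<Longrightarrow> w z = u z"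
  shows "w \<in> angle_polys"
proof -
  have zero: "(\<lambda>z. 0) \<in> angle_polys"
    by (rule angle_polys.monomial[OF coeffs.const[of 0]]) (auto simp: angle_free_def)
  show ?thesis
    by (rule angle_polys.sum[OF assms(1) zero]) (simp add: assms(2))
qed

lemma angle_polys_mult:
  "u \<in> angle_polys \<Longrightarrow> w \<in> angle_polys \<Longrightarrow> (\<lambda>z. u z * w z) \<in> angle_polys"
proof (induction rule: angle_polys.induct)
  case (monomial c u k)
  note c = monomial.hyps
  from monomial.prems show ?case
  proof (induction rule: angle_polys.induct)
    case (monomial c' w l)
    show ?case
    proof (rule angle_polys.monomial)
      show "(\<lambda>z. c z * c' z) \<in> coeffs"
        using c(1) monomial.hyps(1) by (rule coeffs.mult)
      show "angle_free (\<lambda>z. c z * c' z)"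
        using c(2) monomial.hyps(2) unfolding angle_free_def by metis
      show "u z * w z = c z * c' z * fst (snd z) ^ (k + l)" if "0 < fst z" for z
        using c(3)[OF that] monomial.hyps(3)[OF that] by (simp add: power_add)
    qed
  next
    case (sum w w' v)
    show ?case
      by (rule angle_polys.sum[OF sum.IH]) (simp add: sum.hyps algebra_simps)
  qed
next
  case (sum u u' v)
  show ?case
    by (rule angle_polys.sum[OF sum.IH[OF sum.prems]]) (simp add: sum.hyps algebra_simps)
qed

lemma coeffs_angle_polys: "u \<in> coeffs \<Longrightarrow> u \<in> angle_polys"
proof (induction rule: coeffs.induct)
  case angle
  show ?case
    by (rule angle_polys.monomial[OF coeffs.const[of 1], of _ 1]) (auto simp: angle_free_def)
next
  case (add u w)
  then show ?case by (intro angle_polys.sum[OF add.IH]) simp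
next
  case (mult u w)
  then show ?case by (intro angle_polys_mult)
next
  case (agree u w)
  show ?case by (rule angle_polys_agree[OF agree.IH agree.hyps(2)])
next
  case (const c)
  show ?case
    by (rule angle_polys.monomial[OF coeffs.const[of c], of _ 0]) (auto simp: angle_free_def)
next
  case action
  show ?case
    by (rule angle_polys.monomial[OF coeffs.action, of _ 0]) (auto simp: angle_free_def)
next
  case inv_action
  show ?case
    by (rule angle_polys.monomial[OF coeffs.inv_action, of _ 0]) (auto simp: angle_free_def)
next
  case momentum
  show ?case
    by (rule angle_polys.monomial[OF coeffs.momentum, of _ 0]) (auto simp: angle_free_def)
next
  case (profile_deriv k)
  show ?case
    by (rule angle_polys.monomial[OF coeffs.profile_deriv, of _ _ 0]) (auto simp: angle_free_def)
next
  case inv_profile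
  show ?case
    by (rule angle_polys.monomial[OF coeffs.inv_profile, of _ 0]) (auto simp: angle_free_def)
qed

lemma angle_polys_antiderivative:
  assumes "u \<in> angle_polys"
  shows "\<exists>A\<in>coeffs. \<forall>z. 0 < fst z \<longrightarrow> D e_angle A z = u z"
  using assms
proof (induction rule: angle_polys.induct)
  case (monomial c u k)
  let ?A = "\<lambda>z. c z * ((\<lambda>(J, s, p, X). s) z ^ Suc k * inverse (real (Suc k)))"
  have "D e_angle ?A z = u z" if z: "0 < fst z" for z
  proof -
    obtain J s p X where zz: "z = (J, s, p, X)" "0 < J" using z by (cases z) auto
    have A: "?A \<in> coeffs" by (intro coeffs_intros monomial.hyps)
    obtain c0 where c0: "c (J, s', p, X) = c0" for s'
      using monomial.hyps(2) zz(2) unfolding angle_free_def by blast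
    have "((\<lambda>s'. c0 * (s' ^ Suc k * inverse (real (Suc k)))) has_field_derivative c0 * s ^ k) (at s)"
      by (auto intro!: derivative_eq_intros simp del: of_nat_Suc power_Suc)
    then have "((\<lambda>s'. ?A (J, s', p, X)) has_field_derivative c (J, s, p, X) * s ^ k) (at s)"
      by (simp only: prod.case c0)
    from DERIV_unique[OF coeffs_partial(2)[OF A zz(2)] this]
    show ?thesis
      using monomial.hyps(3)[OF z] zz by simp
  qed
  moreover have "?A \<in> coeffs" by (intro coeffs_intros monomial.hyps)
  ultimately show ?case by blast
next
  case (sum u w v)
  then obtain A B where AB: "A \<in> coeffs" "\<And>z. 0 < fst z \<Longrightarrow> D e_angle A z = u z"
    "B \<in> coeffs" "\<And>z. 0 < fst z \<Longrightarrow> D e_angle B z = w z" by blast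
  show ?case
    by (rule bexI[OF _ coeffs.add[OF AB(1,3)]]) (simp add: AB D_add coeffs_differentiable sum.hyps)
qed

lemma angle_antiderivative:
  assumes "u \<in> coeffs"
  obtains A where "A \<in> coeffs" "\<And>z. 0 < fst z \<Longrightarrow> D e_angle A z = u z"
  using angle_polys_antiderivative[OF coeffs_angle_polys[OF assms]] by blast

end

section \<open>Asymptotic expansions in \<open>\<epsilon>\<close>\<close>

text \<open>Both the constant and the range of admissible \<open>\<epsilon>\<close> may depend on the box, but on nothing else.\<close>

definition of_order :: "nat \<Rightarrow> (real \<Rightarrow> phase \<Rightarrow> real) \<Rightarrow> bool" where
  "of_order N F \<longleftrightarrow> (\<forall>m>0. \<exists>C. \<forall>\<^sub>F \<epsilon> in at_right 0. \<forall>z\<in>phase_box m. \<bar>F \<epsilon> z\<bar> \<le> C * \<epsilon> ^ N)"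

lemma of_orderE:
  assumes "of_order N F" "0 < m"
  obtains C where "0 < C" "\<forall>\<^sub>F \<epsilon> in at_right 0. \<forall>z\<in>phase_box m. \<bar>F \<epsilon> z\<bar> \<le> C * \<epsilon> ^ N"
proof -
  obtain C where C: "\<forall>\<^sub>F \<epsilon> in at_right 0. \<forall>z\<in>phase_box m. \<bar>F \<epsilon> z\<bar> \<le> C * \<epsilon> ^ N"
    using assms unfolding of_order_def by blast
  have "\<forall>\<^sub>F \<epsilon> in at_right 0. \<forall>z\<in>phase_box m. \<bar>F \<epsilon> z\<bar> \<le> (\<bar>C\<bar> + 1) * \<epsilon> ^ N"
    using C eventually_at_right_less[of 0]
  proof eventually_elim
    case (elim \<epsilon>)
    then have "C * \<epsilon> ^ N \<le> (\<bar>C\<bar> + 1) * \<epsilon> ^ N"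
      by (intro mult_right_mono) auto
    then show ?case
      using elim by (meson order_trans)
  qed
  then show ?thesis
    by (intro that[of "\<bar>C\<bar> + 1"]) auto
qed

lemma of_order_dominated:
  assumes "of_order N G"
    and "\<And>m. 0 < m \<Longrightarrow>
      \<exists>c\<ge>0. \<forall>\<^sub>F \<epsilon> in at_right 0. \<forall>z\<in>phase_box m. \<bar>F \<epsilon> z\<bar> \<le> c * \<epsilon> ^ k * \<bar>G \<epsilon> z\<bar>"
  shows "of_order (k + N) F"
  unfolding of_order_def
proof (intro allI impI)
  fix m :: real assume "0 < m"
  obtain C where C: "0 < C" "\<forall>\<^sub>F \<epsilon> in at_right 0. \<forall>z\<in>phase_box m. \<bar>G \<epsilon> z\<bar> \<le> C * \<epsilon> ^ N"
    using of_orderE[OF assms(1) \<open>0 < m\<close>] by blast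
  obtain c where c: "0 \<le> c"
    "\<forall>\<^sub>F \<epsilon> in at_right 0. \<forall>z\<in>phase_box m. \<bar>F \<epsilon> z\<bar> \<le> c * \<epsilon> ^ k * \<bar>G \<epsilon> z\<bar>"
    using assms(2)[OF \<open>0 < m\<close>] by blast
  have "\<forall>\<^sub>F \<epsilon> in at_right 0. \<forall>z\<in>phase_box m. \<bar>F \<epsilon> z\<bar> \<le> c * C * \<epsilon> ^ (k + N)"
    using C(2) c(2) eventually_at_right_less[of 0]
  proof eventually_elim
    case (elim \<epsilon>)
    show ?case
    proof
      fix z assume "z \<in> phase_box m"
      then have "\<bar>F \<epsilon> z\<bar> \<le> c * \<epsilon> ^ k * \<bar>G \<epsilon> z\<bar>" "\<bar>G \<epsilon> z\<bar> \<le> C * \<epsilon> ^ N"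
        using elim by blast+
      then have "\<bar>F \<epsilon> z\<bar> \<le> c * \<epsilon> ^ k * (C * \<epsilon> ^ N)"
        using c(1) elim(3) by (meson mult_left_mono mult_nonneg_nonneg order_trans zero_le_power less_imp_le)
      then show "\<bar>F \<epsilon> z\<bar> \<le> c * C * \<epsilon> ^ (k + N)"
        by (simp add: power_add mult_ac)
    qed
  qed
  then show "\<exists>C. \<forall>\<^sub>F \<epsilon> in at_right 0. \<forall>z\<in>phase_box m. \<bar>F \<epsilon> z\<bar> \<le> C * \<epsilon> ^ (k + N)" ..
qed

lemma of_order_cong:
  assumes "of_order N G"
    and "\<And>\<epsilon> J s p X. 0 < \<epsilon> \<Longrightarrow> 0 < J \<Longrightarrow> \<bar>s\<bar> \<le> pi \<Longrightarrow> F \<epsilon> (J, s, p, X) = G \<epsilon> (J, s, p, X)"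
  shows "of_order N F"
proof -
  have "\<forall>\<^sub>F \<epsilon> in at_right 0. \<forall>z\<in>phase_box m. \<bar>F \<epsilon> z\<bar> \<le> 1 * \<epsilon> ^ 0 * \<bar>G \<epsilon> z\<bar>" if "0 < m" for m
    using eventually_at_right_less[of 0]
  proof eventually_elim
    case (elim \<epsilon>)
    show ?case
    proof
      fix z assume z: "z \<in> phase_box m"
      obtain J s p X where "z = (J, s, p, X)" by (cases z)
      then show "\<bar>F \<epsilon> z\<bar> \<le> 1 * \<epsilon> ^ 0 * \<bar>G \<epsilon> z\<bar>"
        using assms(2)[OF elim, of J s p X] box_positive_action[OF that z] z
        by (simp add: phase_box_def abs_le_iff)
    qed
  qed
  then have "of_order (0 + N) F"
    by (intro of_order_dominated[OF assms(1)]) (use zero_le_one in blast)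
  then show ?thesis by simp
qed

lemma of_order_add:
  assumes "of_order N F" "of_order N G"
  shows "of_order N (\<lambda>\<epsilon> z. F \<epsilon> z + G \<epsilon> z)"
  unfolding of_order_def
proof (intro allI impI)
  fix m :: real assume "0 < m"
  obtain B C where BC: "\<forall>\<^sub>F \<epsilon> in at_right 0. \<forall>z\<in>phase_box m. \<bar>F \<epsilon> z\<bar> \<le> B * \<epsilon> ^ N"
    "\<forall>\<^sub>F \<epsilon> in at_right 0. \<forall>z\<in>phase_box m. \<bar>G \<epsilon> z\<bar> \<le> C * \<epsilon> ^ N"
    using assms \<open>0 < m\<close> unfolding of_order_def by blast
  have "\<forall>\<^sub>F \<epsilon> in at_right 0. \<forall>z\<in>phase_box m. \<bar>F \<epsilon> z + G \<epsilon> z\<bar> \<le> (B + C) * \<epsilon> ^ N"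
    using BC
  proof eventually_elim
    case (elim \<epsilon>)
    show ?case
    proof
      fix z assume "z \<in> phase_box m"
      then have "\<bar>F \<epsilon> z\<bar> \<le> B * \<epsilon> ^ N" "\<bar>G \<epsilon> z\<bar> \<le> C * \<epsilon> ^ N"
        using elim by blast+
      then show "\<bar>F \<epsilon> z + G \<epsilon> z\<bar> \<le> (B + C) * \<epsilon> ^ N"
        unfolding distrib_right by linarith
    qed
  qed
  then show "\<exists>C. \<forall>\<^sub>F \<epsilon> in at_right 0. \<forall>z\<in>phase_box m. \<bar>F \<epsilon> z + G \<epsilon> z\<bar> \<le> C * \<epsilon> ^ N" ..
qed

lemma of_order_mult:
  assumes "of_order M F" "of_order N G"
  shows "of_order (M + N) (\<lambda>\<epsilon> z. F \<epsilon> z * G \<epsilon> z)"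
proof (rule of_order_dominated[OF assms(2)])
  fix m :: real assume "0 < m"
  then obtain C where C: "0 < C" "\<forall>\<^sub>F \<epsilon> in at_right 0. \<forall>z\<in>phase_box m. \<bar>F \<epsilon> z\<bar> \<le> C * \<epsilon> ^ M"
    using of_orderE[OF assms(1)] by blast
  show "\<exists>c\<ge>0. \<forall>\<^sub>F \<epsilon> in at_right 0. \<forall>z\<in>phase_box m. \<bar>F \<epsilon> z * G \<epsilon> z\<bar> \<le> c * \<epsilon> ^ M * \<bar>G \<epsilon> z\<bar>"
  proof (intro exI[of _ C] conjI)
    show "\<forall>\<^sub>F \<epsilon> in at_right 0. \<forall>z\<in>phase_box m. \<bar>F \<epsilon> z * G \<epsilon> z\<bar> \<le> C * \<epsilon> ^ M * \<bar>G \<epsilon> z\<bar>"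
      using C(2) by eventually_elim (simp add: abs_mult mult_right_mono)
  qed (use C in simp)
qed

lemma of_order_mono:
  assumes "of_order N F" "M \<le> N"
  shows "of_order M F"
  unfolding of_order_def
proof (intro allI impI)
  fix m :: real assume "0 < m"
  then obtain C where C: "0 < C" "\<forall>\<^sub>F \<epsilon> in at_right 0. \<forall>z\<in>phase_box m. \<bar>F \<epsilon> z\<bar> \<le> C * \<epsilon> ^ N"
    using of_orderE[OF assms(1)] by blast
  have "\<forall>\<^sub>F \<epsilon> in at_right 0. \<epsilon> < (1::real)"
    by (simp add: eventually_at_right_field exI[of _ 1])
  then have "\<forall>\<^sub>F \<epsilon> in at_right 0. \<forall>z\<in>phase_box m. \<bar>F \<epsilon> z\<bar> \<le> C * \<epsilon> ^ M"
    using C(2) eventually_at_right_less[of 0]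
  proof eventually_elim
    case (elim \<epsilon>)
    have "C * \<epsilon> ^ N \<le> C * \<epsilon> ^ M"
      using elim assms(2) C(1) by (intro mult_left_mono power_decreasing) auto
    then show ?case using elim by (meson order_trans)
  qed
  then show "\<exists>C. \<forall>\<^sub>F \<epsilon> in at_right 0. \<forall>z\<in>phase_box m. \<bar>F \<epsilon> z\<bar> \<le> C * \<epsilon> ^ M" ..
qed

lemma of_order_eps_power: "of_order k (\<lambda>\<epsilon> z. \<epsilon> ^ k)"
  unfolding of_order_def
  by (intro allI impI exI[of _ 1])
    (use eventually_at_right_less[of 0] in \<open>eventually_elim, auto\<close>)

lemma of_order_minus: "of_order N F \<Longrightarrow> of_order N (\<lambda>\<epsilon> z. - F \<epsilon> z)"
  unfolding of_order_def by simp

lemma of_order_diff: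
  "of_order N F \<Longrightarrow> of_order N G \<Longrightarrow> of_order N (\<lambda>\<epsilon> z. F \<epsilon> z - G \<epsilon> z)"
  using of_order_add[OF _ of_order_minus] by simp

lemma of_order_power_mult:
  "of_order N F \<Longrightarrow> of_order (k + N) (\<lambda>\<epsilon> z. \<epsilon> ^ k * F \<epsilon> z)"
  by (intro of_order_mult of_order_eps_power)

lemma of_order_divide_eps:
  assumes "of_order (Suc N) (\<lambda>\<epsilon> z. \<epsilon> * F \<epsilon> z)"
  shows "of_order N F"
  unfolding of_order_def
proof (intro allI impI)
  fix m :: real assume "0 < m"
  then obtain C where C: "\<forall>\<^sub>F \<epsilon> in at_right 0. \<forall>z\<in>phase_box m. \<bar>\<epsilon> * F \<epsilon> z\<bar> \<le> C * \<epsilon> ^ Suc N"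
    using of_orderE[OF assms(1)] by blast
  have "\<forall>\<^sub>F \<epsilon> in at_right 0. \<forall>z\<in>phase_box m. \<bar>F \<epsilon> z\<bar> \<le> C * \<epsilon> ^ N"
    using C eventually_at_right_less[of 0]
  proof eventually_elim
    case (elim \<epsilon>)
    show ?case
    proof
      fix z assume "z \<in> phase_box m"
      then have "\<epsilon> * \<bar>F \<epsilon> z\<bar> \<le> \<epsilon> * (C * \<epsilon> ^ N)"
        using elim by (auto simp: abs_mult mult_ac)
      then show "\<bar>F \<epsilon> z\<bar> \<le> C * \<epsilon> ^ N"
        using elim by simp
    qed
  qed
  then show "\<exists>C. \<forall>\<^sub>F \<epsilon> in at_right 0. \<forall>z\<in>phase_box m. \<bar>F \<epsilon> z\<bar> \<le> C * \<epsilon> ^ N" ..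
qed

text \<open>Uniqueness of asymptotic expansions rests on this: a function that does not depend on \<open>\<epsilon>\<close> and is
  \<open>O(\<epsilon>)\<close> vanishes. Only \<open>\<bar>s\<bar> \<le> \<pi>\<close> is seen by the boxes.\<close>

lemma of_order_Suc_const_imp_zero:
  assumes "of_order (Suc N) (\<lambda>\<epsilon>. a)" "0 < J" "\<bar>s\<bar> \<le> pi"
  shows "a (J, s, p, X) = 0"
proof -
  define m where "m = J + inverse J + \<bar>p\<bar>"
  have iJ: "0 < inverse J" using \<open>0 < J\<close> by simp
  then have m: "0 < m" "J \<le> m" "inverse J \<le> m" "\<bar>p\<bar> \<le> m"
    using \<open>0 < J\<close> unfolding m_def by linarith+
  have "inverse m \<le> J"
    using le_imp_inverse_le[OF m(3) iJ] by simp
  then have "(J, s, p, X) \<in> phase_box m"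
    using m(2,4) \<open>\<bar>s\<bar> \<le> pi\<close> unfolding phase_box_def by (simp add: abs_le_iff)
  moreover have "of_order 1 (\<lambda>\<epsilon>. a)"
    by (rule of_order_mono[OF assms(1)]) simp
  then obtain C where "\<forall>\<^sub>F \<epsilon> in at_right 0. \<forall>z\<in>phase_box m. \<bar>a z\<bar> \<le> C * \<epsilon> ^ 1"
    using of_orderE m(1) by blast
  ultimately have "\<forall>\<^sub>F \<epsilon> in at_right 0. \<bar>a (J, s, p, X)\<bar> \<le> C * \<epsilon>"
    by (auto elim: eventually_mono)
  moreover have "((\<lambda>\<epsilon>. C * \<epsilon>) \<longlongrightarrow> C * 0) (at_right 0)"
    by (intro tendsto_intros)
  ultimately have "\<bar>a (J, s, p, X)\<bar> \<le> C * 0"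
    by (intro tendsto_lowerbound) auto
  then show ?thesis by simp
qed

definition shift :: "(phase \<Rightarrow> real) \<Rightarrow> real \<Rightarrow> phase \<Rightarrow> real" where
  "shift u t = (\<lambda>(J, s, p, X). u (J, s, p, X + t))"

context waveguide
begin

lemma of_order_coeffs: "u \<in> coeffs \<Longrightarrow> of_order 0 (\<lambda>\<epsilon>. u)"
  unfolding of_order_def using coeffs_bounded[of u] by (auto intro: always_eventually)

text \<open>An expansion up to order \<open>N\<close> is peeled off one coefficient at a time. In this form products need
  only \<open>(a + \<epsilon>G)(a' + \<epsilon>G') = aa' + \<epsilon>(aG' + Ga' + \<epsilon>GG')\<close> and an induction, instead of convolutions of
  coefficient sequences.\<close>

primrec expands :: "nat \<Rightarrow> (real \<Rightarrow> phase \<Rightarrow> real) \<Rightarrow> bool" where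
  "expands 0 F \<longleftrightarrow> of_order 0 F"
| "expands (Suc N) F \<longleftrightarrow> (\<exists>a\<in>coeffs. \<exists>G. expands N G \<and>
     (\<forall>\<epsilon> J s p X. 0 < \<epsilon> \<longrightarrow> 0 < J \<longrightarrow> \<bar>s\<bar> \<le> pi \<longrightarrow>
        F \<epsilon> (J, s, p, X) = a (J, s, p, X) + \<epsilon> * G \<epsilon> (J, s, p, X)))"

lemma expands_cong:
  assumes "expands N G"
    and "\<And>\<epsilon> J s p X. 0 < \<epsilon> \<Longrightarrow> 0 < J \<Longrightarrow> \<bar>s\<bar> \<le> pi \<Longrightarrow> F \<epsilon> (J, s, p, X) = G \<epsilon> (J, s, p, X)"
  shows "expands N F"
  using assms by (cases N) (auto intro: of_order_cong)

lemma expands_SucI: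
  assumes "a \<in> coeffs" "expands N G"
    and "\<And>\<epsilon> J s p X. 0 < \<epsilon> \<Longrightarrow> 0 < J \<Longrightarrow> \<bar>s\<bar> \<le> pi \<Longrightarrow>
        F \<epsilon> (J, s, p, X) = a (J, s, p, X) + \<epsilon> * G \<epsilon> (J, s, p, X)"
  shows "expands (Suc N) F"
  using assms by auto

lemma expands_SucE:
  assumes "expands (Suc N) F"
  obtains a G where "a \<in> coeffs" "expands N G"
    "\<And>\<epsilon> J s p X. 0 < \<epsilon> \<Longrightarrow> 0 < J \<Longrightarrow> \<bar>s\<bar> \<le> pi \<Longrightarrow>
        F \<epsilon> (J, s, p, X) = a (J, s, p, X) + \<epsilon> * G \<epsilon> (J, s, p, X)"
  using assms by auto

lemma expands_imp_of_order: "expands N F \<Longrightarrow> of_order 0 F"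
proof (induction N arbitrary: F)
  case (Suc N)
  from Suc.prems obtain a G where a: "a \<in> coeffs" "expands N G"
    and F: "\<And>\<epsilon> J s p X. 0 < \<epsilon> \<Longrightarrow> 0 < J \<Longrightarrow> \<bar>s\<bar> \<le> pi \<Longrightarrow>
        F \<epsilon> (J, s, p, X) = a (J, s, p, X) + \<epsilon> * G \<epsilon> (J, s, p, X)"
    by (rule expands_SucE) blast
  have "of_order 0 (\<lambda>\<epsilon> z. \<epsilon> ^ 1 * G \<epsilon> z)"
    by (rule of_order_mono[OF of_order_power_mult[OF Suc.IH[OF a(2)], of 1]]) simp
  from of_order_add[OF of_order_coeffs[OF a(1)] this] show ?case
    by (rule of_order_cong) (simp add: F)
qed simp

text \<open>Remainders count as expandable; this allows Taylor polynomials and their remainders to be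
  treated separately.\<close>

lemma expands_of_order: "of_order N F \<Longrightarrow> expands N F"
proof (induction N arbitrary: F)
  case (Suc N)
  have "of_order N (\<lambda>\<epsilon> z. F \<epsilon> z / \<epsilon>)"
    by (rule of_order_divide_eps, rule of_order_cong[OF Suc.prems]) simp
  note G = Suc.IH[OF this]
  show ?case
    by (rule expands_SucI[OF coeffs.const[of 0] G]) simp
qed simp

lemma expands_coeffs: "u \<in> coeffs \<Longrightarrow> expands N (\<lambda>\<epsilon>. u)"
proof (cases N)
  case (Suc N')
  assume "u \<in> coeffs"
  have "of_order N' (\<lambda>\<epsilon> z. 0)"
    unfolding of_order_def by (intro allI impI exI[of _ 0]) simp
  note G = expands_of_order[OF this]
  show ?thesis
    unfolding Suc by (rule expands_SucI[OF \<open>u \<in> coeffs\<close> G]) simp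
qed (simp add: of_order_coeffs)

lemma expands_Suc_imp: "expands (Suc N) F \<Longrightarrow> expands N F"
proof (induction N arbitrary: F)
  case 0
  then show ?case using expands_imp_of_order by (metis expands.simps(1))
next
  case (Suc N)
  from Suc.prems show ?case
    by (rule expands_SucE) (rule expands_SucI[OF _ Suc.IH])
qed

lemma expands_eps_mult_Suc: "expands N F \<Longrightarrow> expands (Suc N) (\<lambda>\<epsilon> z. \<epsilon> * F \<epsilon> z)"
  by (rule expands_SucI[OF coeffs.const[of 0]]) auto

lemma expands_eps_mult: "expands N F \<Longrightarrow> expands N (\<lambda>\<epsilon> z. \<epsilon> * F \<epsilon> z)"
  by (rule expands_Suc_imp[OF expands_eps_mult_Suc])

lemma expands_add: "expands N F \<Longrightarrow> expands N F' \<Longrightarrow> expands N (\<lambda>\<epsilon> z. F \<epsilon> z + F' \<epsilon> z)"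
proof (induction N arbitrary: F F')
  case 0
  then show ?case by (simp add: of_order_add)
next
  case (Suc N)
  from Suc.prems(1) obtain a G where a: "a \<in> coeffs" "expands N G"
    and F: "\<And>\<epsilon> J s p X. 0 < \<epsilon> \<Longrightarrow> 0 < J \<Longrightarrow> \<bar>s\<bar> \<le> pi \<Longrightarrow>
        F \<epsilon> (J, s, p, X) = a (J, s, p, X) + \<epsilon> * G \<epsilon> (J, s, p, X)"
    by (rule expands_SucE) blast
  from Suc.prems(2) obtain a' G' where a': "a' \<in> coeffs" "expands N G'"
    and F': "\<And>\<epsilon> J s p X. 0 < \<epsilon> \<Longrightarrow> 0 < J \<Longrightarrow> \<bar>s\<bar> \<le> pi \<Longrightarrow>
        F' \<epsilon> (J, s, p, X) = a' (J, s, p, X) + \<epsilon> * G' \<epsilon> (J, s, p, X)"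
    by (rule expands_SucE) blast
  show ?case
    by (rule expands_SucI[OF coeffs.add[OF a(1) a'(1)] Suc.IH[OF a(2) a'(2)]])
      (simp add: F F' algebra_simps)
qed

lemma expands_mult: "expands N F \<Longrightarrow> expands N F' \<Longrightarrow> expands N (\<lambda>\<epsilon> z. F \<epsilon> z * F' \<epsilon> z)"
proof (induction N arbitrary: F F')
  case 0
  then show ?case using of_order_mult[of 0 F 0 F'] by simp
next
  case (Suc N)
  from Suc.prems(1) obtain a G where a: "a \<in> coeffs" "expands N G"
    and F: "\<And>\<epsilon> J s p X. 0 < \<epsilon> \<Longrightarrow> 0 < J \<Longrightarrow> \<bar>s\<bar> \<le> pi \<Longrightarrow>
        F \<epsilon> (J, s, p, X) = a (J, s, p, X) + \<epsilon> * G \<epsilon> (J, s, p, X)"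
    by (rule expands_SucE) blast
  from Suc.prems(2) obtain a' G' where a': "a' \<in> coeffs" "expands N G'"
    and F': "\<And>\<epsilon> J s p X. 0 < \<epsilon> \<Longrightarrow> 0 < J \<Longrightarrow> \<bar>s\<bar> \<le> pi \<Longrightarrow>
        F' \<epsilon> (J, s, p, X) = a' (J, s, p, X) + \<epsilon> * G' \<epsilon> (J, s, p, X)"
    by (rule expands_SucE) blast
  have "expands N (\<lambda>\<epsilon> z. a z * G' \<epsilon> z + (G \<epsilon> z * a' z + \<epsilon> * (G \<epsilon> z * G' \<epsilon> z)))"
    by (intro expands_add expands_eps_mult Suc.IH expands_coeffs a a')
  then show ?case
    by (rule expands_SucI[OF coeffs.mult[OF a(1) a'(1)]]) (simp add: F F' algebra_simps)
qed

lemma expands_minus: "expands N F \<Longrightarrow> expands N (\<lambda>\<epsilon> z. - F \<epsilon> z)"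
  using expands_mult[OF expands_coeffs[OF coeffs.const[of "-1"]]] by simp

lemma expands_diff: "expands N F \<Longrightarrow> expands N G \<Longrightarrow> expands N (\<lambda>\<epsilon> z. F \<epsilon> z - G \<epsilon> z)"
  using expands_add[OF _ expands_minus] by simp

lemma expands_eps_power: "expands N (\<lambda>\<epsilon> z. \<epsilon> ^ k)"
  by (induction k) (auto intro: expands_coeffs coeffs.const expands_eps_mult)

lemma expands_power: "expands N F \<Longrightarrow> expands N (\<lambda>\<epsilon> z. F \<epsilon> z ^ k)"
  by (induction k) (auto intro: expands_coeffs coeffs.const expands_mult)

lemma expands_sum: "(\<And>i. i \<in> A \<Longrightarrow> expands N (F i)) \<Longrightarrow> expands N (\<lambda>\<epsilon> z. \<Sum>i\<in>A. F i \<epsilon> z)"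
  by (induction A rule: infinite_finite_induct)
    (auto intro: expands_coeffs coeffs.const expands_add)

text \<open>The coefficients of the lower orders vanish one after another, because the whole function is
  too small to leave room for them.\<close>

lemma expands_leading_term:
  assumes "expands (Suc N) F" "of_order N F"
  obtains a where "a \<in> coeffs" "of_order (Suc N) (\<lambda>\<epsilon> z. F \<epsilon> z - \<epsilon> ^ N * a z)"
  using assms
proof (induction N arbitrary: F thesis)
  case 0
  from 0(2) obtain a G where a: "a \<in> coeffs" "expands 0 G"
    and F: "\<And>\<epsilon> J s p X. 0 < \<epsilon> \<Longrightarrow> 0 < J \<Longrightarrow> \<bar>s\<bar> \<le> pi \<Longrightarrow>
        F \<epsilon> (J, s, p, X) = a (J, s, p, X) + \<epsilon> * G \<epsilon> (J, s, p, X)"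
    by (rule expands_SucE) blast
  have "of_order (Suc 0) (\<lambda>\<epsilon> z. \<epsilon> ^ 1 * G \<epsilon> z)"
    using of_order_power_mult[of 0 G 1] a(2) by simp
  then have "of_order (Suc 0) (\<lambda>\<epsilon> z. F \<epsilon> z - \<epsilon> ^ 0 * a z)"
    by (rule of_order_cong) (simp add: F)
  then show ?case by (rule 0(1)[OF a(1)])
next
  case (Suc N)
  from Suc.prems(2) obtain a G where a: "a \<in> coeffs" "expands (Suc N) G"
    and F: "\<And>\<epsilon> J s p X. 0 < \<epsilon> \<Longrightarrow> 0 < J \<Longrightarrow> \<bar>s\<bar> \<le> pi \<Longrightarrow>
        F \<epsilon> (J, s, p, X) = a (J, s, p, X) + \<epsilon> * G \<epsilon> (J, s, p, X)"
    by (rule expands_SucE) blast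
  have "of_order 1 (\<lambda>\<epsilon> z. F \<epsilon> z - \<epsilon> ^ 1 * G \<epsilon> z)"
    using of_order_diff[OF of_order_mono[OF Suc.prems(3), of 1]
        of_order_mono[OF of_order_power_mult[OF expands_imp_of_order[OF a(2)], of 1]]] by simp
  then have "of_order (Suc 0) (\<lambda>\<epsilon>. a)"
    unfolding One_nat_def[symmetric] by (rule of_order_cong) (simp add: F)
  then have a0: "a (J, s, p, X) = 0" if "0 < J" "\<bar>s\<bar> \<le> pi" for J s p X
    using of_order_Suc_const_imp_zero that by blast
  have "of_order (Suc N) (\<lambda>\<epsilon> z. \<epsilon> * G \<epsilon> z)"
    by (rule of_order_cong[OF Suc.prems(3)]) (simp add: F a0)
  then have "of_order N G" by (rule of_order_divide_eps)
  from Suc.IH[OF _ a(2) this] obtain b where b: "b \<in> coeffs"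
    "of_order (Suc N) (\<lambda>\<epsilon> z. G \<epsilon> z - \<epsilon> ^ N * b z)" by blast
  have "of_order (Suc (Suc N)) (\<lambda>\<epsilon> z. F \<epsilon> z - \<epsilon> ^ Suc N * b z)"
    using of_order_power_mult[OF b(2), of 1] unfolding plus_1_eq_Suc
    by (rule of_order_cong) (simp add: F a0 algebra_simps)
  then show ?case by (rule Suc.prems(1)[OF b(1)])
qed

section \<open>Displacing the slow coordinate\<close>

lemma shift_coeffs_taylor:
  assumes "u \<in> coeffs" "0 < J"
  shows "\<exists>\<theta>. shift u t (J, s, p, X) =
    (\<Sum>k<n. (D e_coord ^^ k) u (J, s, p, X) / fact k * t ^ k)
    + (D e_coord ^^ n) u (J, s, p, X + \<theta>) / fact n * t ^ n"
proof -
  have c: "(D e_coord ^^ k) u \<in> coeffs" for k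
    by (induction k) (auto intro: assms D_coeffs)
  have "\<exists>\<theta>. \<bar>\<theta>\<bar> \<le> \<bar>t\<bar> \<and> shift u t (J, s, p, X) =
    (\<Sum>k<n. (D e_coord ^^ k) u (J, s, p, X + 0) / fact k * t ^ k)
    + (D e_coord ^^ n) u (J, s, p, X + \<theta>) / fact n * t ^ n"
  proof (rule Maclaurin_all_le[where diff = "\<lambda>k y. (D e_coord ^^ k) u (J, s, p, X + y)"])
    show "(\<lambda>y. (D e_coord ^^ 0) u (J, s, p, X + y)) = (\<lambda>t. shift u t (J, s, p, X))"
      by (simp add: shift_def)
    show "\<forall>m x. ((\<lambda>y. (D e_coord ^^ m) u (J, s, p, X + y)) has_real_derivative
        (D e_coord ^^ Suc m) u (J, s, p, X + x)) (at x)"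
    proof (intro allI)
      fix m x
      have "((\<lambda>y. (J, s, p, X + y)) has_derivative (\<lambda>h. h *\<^sub>R e_coord)) (at x)"
        by (auto intro!: derivative_eq_intros simp: zero_prod_def)
      from D_path[OF c _ this] \<open>0 < J\<close>
      show "((\<lambda>y. (D e_coord ^^ m) u (J, s, p, X + y)) has_real_derivative
          (D e_coord ^^ Suc m) u (J, s, p, X + x)) (at x)"
        by simp
    qed
  qed
  then show ?thesis by auto
qed

text \<open>The displacement \<open>\<epsilon>\<^sup>2 T\<close> is itself expandable, so the Taylor polynomial of degree less than \<open>N\<close>
  is too, and the remainder is \<open>O((\<epsilon>\<^sup>2)\<^sup>N)\<close> because the box does not restrict the coordinate, so that
  the intermediate point stays inside.\<close>

lemma expands_shift:
  assumes "u \<in> coeffs" "expands N T"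
  shows "expands N (\<lambda>\<epsilon> z. shift u (\<epsilon>\<^sup>2 * T \<epsilon> z) z)"
proof -
  let ?P = "\<lambda>\<epsilon> z. \<Sum>k<N. (D e_coord ^^ k) u z * (inverse (fact k) * (\<epsilon>\<^sup>2 * T \<epsilon> z) ^ k)"
  have c: "(D e_coord ^^ k) u \<in> coeffs" for k
    by (induction k) (auto intro: assms D_coeffs)
  have P: "expands N ?P"
    by (intro expands_sum expands_mult expands_coeffs c coeffs.const expands_power
        expands_eps_power assms)
  have "of_order (N + 0) (\<lambda>\<epsilon> z. shift u (\<epsilon>\<^sup>2 * T \<epsilon> z) z - ?P \<epsilon> z)"
  proof (rule of_order_dominated)
    show "of_order 0 (\<lambda>\<epsilon> z. (\<epsilon> ^ 1 * T \<epsilon> z) ^ N)"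
      by (rule expands_imp_of_order[of N]) (intro expands_power expands_mult expands_eps_power assms)
  next
    fix m :: real assume "0 < m"
    obtain C where C: "0 < C" "\<And>z. z \<in> phase_box m \<Longrightarrow> \<bar>(D e_coord ^^ N) u z\<bar> \<le> C"
      using coeffs_bounded[OF c \<open>0 < m\<close>] by blast
    have "\<bar>shift u (\<epsilon>\<^sup>2 * T \<epsilon> z) z - ?P \<epsilon> z\<bar> \<le> C * \<epsilon> ^ N * \<bar>(\<epsilon> ^ 1 * T \<epsilon> z) ^ N\<bar>"
      if "0 < \<epsilon>" "z \<in> phase_box m" for \<epsilon> z
    proof -
      obtain J s p X where z: "z = (J, s, p, X)" by (cases z)
      have J: "0 < J" using box_positive_action[OF \<open>0 < m\<close> that(2)] z by simp
      obtain \<theta> where \<theta>: "shift u (\<epsilon>\<^sup>2 * T \<epsilon> z) z = ?P \<epsilon> z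
          + (D e_coord ^^ N) u (J, s, p, X + \<theta>) / fact N * (\<epsilon>\<^sup>2 * T \<epsilon> z) ^ N"
        using shift_coeffs_taylor[OF assms(1) J, of "\<epsilon>\<^sup>2 * T \<epsilon> z" s p X N] z
        by (auto simp: divide_inverse mult_ac)
      have "(J, s, p, X + \<theta>) \<in> phase_box m"
        using that(2) z by (simp add: phase_box_def)
      then have "\<bar>(D e_coord ^^ N) u (J, s, p, X + \<theta>)\<bar> \<le> C * 1"
        using C(2) by simp
      also have "\<dots> \<le> C * fact N"
        using C(1) by (intro mult_left_mono) auto
      finally have rem: "\<bar>(D e_coord ^^ N) u (J, s, p, X + \<theta>) / fact N\<bar> \<le> C"
        by (simp add: abs_divide divide_le_eq)
      have "\<bar>shift u (\<epsilon>\<^sup>2 * T \<epsilon> z) z - ?P \<epsilon> z\<bar> \<le> C * \<bar>(\<epsilon>\<^sup>2 * T \<epsilon> z) ^ N\<bar>"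
        using \<theta> mult_right_mono[OF rem, of "\<bar>(\<epsilon>\<^sup>2 * T \<epsilon> z) ^ N\<bar>"] by (simp add: abs_mult)
      also have "(\<epsilon>\<^sup>2 * T \<epsilon> z) ^ N = \<epsilon> ^ N * (\<epsilon> ^ 1 * T \<epsilon> z) ^ N"
        by (simp add: power_mult_distrib power2_eq_square)
      finally show ?thesis
        using that(1) by (simp add: abs_mult mult_ac)
    qed
    then show "\<exists>c\<ge>0. \<forall>\<^sub>F \<epsilon> in at_right 0. \<forall>z\<in>phase_box m.
        \<bar>shift u (\<epsilon>\<^sup>2 * T \<epsilon> z) z - ?P \<epsilon> z\<bar> \<le> c * \<epsilon> ^ N * \<bar>(\<epsilon> ^ 1 * T \<epsilon> z) ^ N\<bar>"
      using C(1) eventually_at_right_less[of 0]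
      by (intro exI[of _ C] conjI) (auto elim!: eventually_mono)
  qed
  then have "expands N (\<lambda>\<epsilon> z. shift u (\<epsilon>\<^sup>2 * T \<epsilon> z) z - ?P \<epsilon> z)"
    by (intro expands_of_order) simp
  from expands_add[OF this P] show ?thesis by simp
qed

end

section \<open>The homological equation and the normal form\<close>

definition epoly :: "(nat \<Rightarrow> phase \<Rightarrow> real) \<Rightarrow> nat \<Rightarrow> real \<Rightarrow> phase \<Rightarrow> real" where
  "epoly c n \<epsilon> z = (\<Sum>i<n. \<epsilon> ^ i * c i z)"

lemma epoly_0: "epoly c 0 \<epsilon> = (\<lambda>z. 0)"
  by (simp add: epoly_def fun_eq_iff)

lemma epoly_Suc: "epoly c (Suc n) \<epsilon> = (\<lambda>z. epoly c n \<epsilon> z + \<epsilon> ^ n * c n z)"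
  by (simp add: epoly_def fun_eq_iff)

lemma epoly_cong: "(\<And>i. i < n \<Longrightarrow> c i = c' i) \<Longrightarrow> epoly c n = epoly c' n"
  by (simp add: epoly_def fun_eq_iff)

lemma shift_epoly: "shift (epoly c n \<epsilon>) t z = (\<Sum>i<n. \<epsilon> ^ i * shift (c i) t z)"
  by (cases z) (simp add: shift_def epoly_def)

lemma shift_0: "shift u 0 = u"
  by (simp add: shift_def fun_eq_iff)

text \<open>The Hamiltonian at the old point, written in the mixed variables with \<open>s\<close> for \<^term>\<open>saw \<phi>\<close>.
  Here \<open>g\<close> is the sum \<open>S\<close> of the generating function at a fixed \<open>\<epsilon>\<close>.\<close>

definition mixed_ham :: "(real \<Rightarrow> real) \<Rightarrow> real \<Rightarrow> (phase \<Rightarrow> real) \<Rightarrow> phase \<Rightarrow> real" where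
  "mixed_ham d \<epsilon> g = (\<lambda>(J, s, p, X). let I = J + \<epsilon> * D e_angle g (J, s, p, X) in
     pi\<^sup>2 * I\<^sup>2 / (d X)\<^sup>2 +
     (p + \<epsilon>\<^sup>2 * D e_coord g (J, s, p, X) - \<epsilon> * (I * deriv d X / d X) * s)\<^sup>2 - 1)"

text \<open>What remains to be removed when \<open>q\<close> is proposed as the normal form: \<open>q\<close> is evaluated at the new
  coordinate, whose slow version is \<open>X + \<epsilon>\<^sup>2 \<partial>g/\<partial>p\<close>.\<close>

definition defect :: "(real \<Rightarrow> real) \<Rightarrow> real \<Rightarrow> (phase \<Rightarrow> real) \<Rightarrow> (phase \<Rightarrow> real) \<Rightarrow> phase \<Rightarrow> real" where
  "defect d \<epsilon> g q z = mixed_ham d \<epsilon> g z - shift q (\<epsilon>\<^sup>2 * D e_momentum g z) z"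

text \<open>Matching of the values on both sides of the jump of \<^const>\<open>saw\<close>.\<close>

definition angle_periodic :: "(phase \<Rightarrow> real) \<Rightarrow> bool" where
  "angle_periodic u \<longleftrightarrow> (\<forall>J p X. 0 < J \<longrightarrow> u (J, pi, p, X) = u (J, - pi, p, X))"

lemma of_order_sum:
  "(\<And>i. i \<in> A \<Longrightarrow> of_order N (F i)) \<Longrightarrow> of_order N (\<lambda>\<epsilon> z. \<Sum>i\<in>A. F i \<epsilon> z)"
proof (induction A rule: infinite_finite_induct)
  case (insert i A)
  then show ?case by (simp add: of_order_add)
qed (simp_all add: of_order_def exI[of _ 0])

context waveguide
begin

lemma epoly_coeffs: "(\<And>i. c i \<in> coeffs) \<Longrightarrow> epoly c n \<epsilon> \<in> coeffs"
  by (induction n) (auto simp: epoly_0 epoly_Suc intro!: coeffs.const coeffs.add coeffs.mult)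

lemma D_scale_add:
  assumes "u \<in> coeffs" "w \<in> coeffs" "0 < fst z"
  shows "D v (\<lambda>z. u z + a * w z) z = D v u z + a * D v w z"
proof -
  have "(\<lambda>z. a * w z) \<in> coeffs"
    using assms by (intro coeffs_intros)
  then have "D v (\<lambda>z. u z + a * w z) z = D v u z + D v (\<lambda>z. a * w z) z"
    using assms by (intro D_add coeffs_differentiable)
  also have "D v (\<lambda>z. a * w z) z = a * D v w z"
    using assms coeffs_differentiable by (subst D_mult) auto
  finally show ?thesis .
qed

lemma D_epoly:
  assumes "\<And>i. c i \<in> coeffs" "0 < fst z"
  shows "D v (epoly c n \<epsilon>) z = epoly (\<lambda>i. D v (c i)) n \<epsilon> z"
  using assms by (induction n) (simp_all add: epoly_0 epoly_Suc D_scale_add epoly_coeffs)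

lemma expands_epoly:
  assumes "\<And>i. c i \<in> coeffs"
  shows "expands N (epoly c n)"
proof -
  have "expands N (\<lambda>\<epsilon> z. \<Sum>i<n. \<epsilon> ^ i * c i z)"
    by (intro expands_sum expands_mult expands_eps_power expands_coeffs assms)
  then show ?thesis by (simp add: epoly_def[abs_def])
qed

lemma expands_D_epoly:
  assumes "\<And>i. c i \<in> coeffs"
  shows "expands N (\<lambda>\<epsilon>. D v (epoly c n \<epsilon>))"
  by (rule expands_cong[OF expands_epoly[of "\<lambda>i. D v (c i)" N n]])
    (simp_all add: D_epoly assms D_coeffs)

lemma expands_shift_epoly:
  assumes "\<And>i. h i \<in> coeffs" "expands N T"
  shows "expands N (\<lambda>\<epsilon> z. shift (epoly h m \<epsilon>) (\<epsilon>\<^sup>2 * T \<epsilon> z) z)"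
  unfolding shift_epoly
  by (intro expands_sum expands_mult expands_eps_power expands_shift assms)

abbreviation inv_width_sq :: "phase \<Rightarrow> real" where
  "inv_width_sq \<equiv> \<lambda>z. pi\<^sup>2 * ((\<lambda>(J, s, p, X). inverse (d X)) z)\<^sup>2"

abbreviation slope :: "phase \<Rightarrow> real" where
  "slope \<equiv> \<lambda>z. (\<lambda>(J, s, p, X). (deriv ^^ 1) d X) z * (\<lambda>(J, s, p, X). inverse (d X)) z *
     (\<lambda>(J, s, p, X). s) z"

lemma mixed_ham_eq:
  "mixed_ham d \<epsilon> g z =
    inv_width_sq z * ((\<lambda>(J, s, p, X). J) z + \<epsilon> * D e_angle g z)\<^sup>2
    + ((\<lambda>(J, s, p, X). p) z + \<epsilon>\<^sup>2 * D e_coord g z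
        - \<epsilon> * ((\<lambda>(J, s, p, X). J) z + \<epsilon> * D e_angle g z) * slope z)\<^sup>2 - 1"
  by (cases z) (simp add: mixed_ham_def Let_def divide_inverse power_inverse mult_ac)

lemma inv_width_sq_coeffs: "inv_width_sq \<in> coeffs" and slope_coeffs: "slope \<in> coeffs"
  by (intro coeffs_intros)+

lemma expands_eps: "expands N (\<lambda>\<epsilon> z. \<epsilon>)"
  using expands_eps_power[of N 1] by simp

lemma expands_defect:
  assumes "\<And>i. c i \<in> coeffs" "\<And>i. h i \<in> coeffs"
  shows "expands N (\<lambda>\<epsilon>. defect d \<epsilon> (epoly c n \<epsilon>) (epoly h m \<epsilon>))"
proof -
  have "expands N (\<lambda>\<epsilon> z. mixed_ham d \<epsilon> (epoly c n \<epsilon>) z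
      - shift (epoly h m \<epsilon>) (\<epsilon>\<^sup>2 * D e_momentum (epoly c n \<epsilon>) z) z)"
    unfolding mixed_ham_eq
    by (intro expands_diff expands_add expands_mult expands_power expands_eps expands_eps_power
        expands_shift_epoly expands_D_epoly assms expands_coeffs inv_width_sq_coeffs slope_coeffs
        coeffs_intros)
  then show ?thesis by (simp add: defect_def[abs_def])
qed

text \<open>The mean value theorem in the coordinate, whose derivative is bounded on the box.\<close>

lemma of_order_shift_increment:
  assumes "u \<in> coeffs" "of_order 0 T"
  shows "of_order k (\<lambda>\<epsilon> z. shift u (t \<epsilon> z + \<epsilon> ^ k * T \<epsilon> z) z - shift u (t \<epsilon> z) z)"
proof -
  have "of_order (k + 0) (\<lambda>\<epsilon> z. shift u (t \<epsilon> z + \<epsilon> ^ k * T \<epsilon> z) z - shift u (t \<epsilon> z) z)"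
  proof (rule of_order_dominated[OF assms(2)])
    fix m :: real assume "0 < m"
    obtain C where C: "0 < C" "\<And>z. z \<in> phase_box m \<Longrightarrow> \<bar>D e_coord u z\<bar> \<le> C"
      using coeffs_bounded[OF D_coeffs[OF assms(1)] \<open>0 < m\<close>] by blast
    have "\<bar>shift u (t \<epsilon> z + \<epsilon> ^ k * T \<epsilon> z) z - shift u (t \<epsilon> z) z\<bar> \<le> C * \<epsilon> ^ k * \<bar>T \<epsilon> z\<bar>"
      if "0 < \<epsilon>" "z \<in> phase_box m" for \<epsilon> z
    proof -
      obtain J s p X where z: "z = (J, s, p, X)" by (cases z)
      have J: "0 < J" using box_positive_action[OF \<open>0 < m\<close> that(2)] z by simp
      obtain \<theta> where "shift u (\<epsilon> ^ k * T \<epsilon> z) (J, s, p, X + t \<epsilon> z) = u (J, s, p, X + t \<epsilon> z)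
          + D e_coord u (J, s, p, X + t \<epsilon> z + \<theta>) * (\<epsilon> ^ k * T \<epsilon> z)"
        using shift_coeffs_taylor[OF assms(1) J, of "\<epsilon> ^ k * T \<epsilon> z" s p "X + t \<epsilon> z" 1]
        by auto
      moreover have "\<bar>D e_coord u (J, s, p, X + t \<epsilon> z + \<theta>)\<bar> \<le> C"
        using that(2) z by (intro C(2)) (simp add: phase_box_def)
      then have "\<bar>D e_coord u (J, s, p, X + t \<epsilon> z + \<theta>)\<bar> * (\<epsilon> ^ k * \<bar>T \<epsilon> z\<bar>) \<le> C * (\<epsilon> ^ k * \<bar>T \<epsilon> z\<bar>)"
        using that(1) by (intro mult_right_mono) auto
      ultimately show ?thesis
        using that(1) z by (simp add: shift_def abs_mult add.assoc mult.assoc)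
    qed
    then show "\<exists>c\<ge>0. \<forall>\<^sub>F \<epsilon> in at_right 0. \<forall>z\<in>phase_box m.
        \<bar>shift u (t \<epsilon> z + \<epsilon> ^ k * T \<epsilon> z) z - shift u (t \<epsilon> z) z\<bar> \<le> c * \<epsilon> ^ k * \<bar>T \<epsilon> z\<bar>"
      using C(1) eventually_at_right_less[of 0]
      by (intro exI[of _ C] conjI) (auto elim!: eventually_mono)
  qed
  then show ?thesis by simp
qed

text \<open>The increment of the squared action contributes \<open>2 J \<epsilon>^(n+1) \<partial>S/\<partial>\<phi>\<close> to leading order. The new
  terms in the momentum carry one more power of \<open>\<epsilon>\<close>, from \<open>\<epsilon>\<^sup>2 \<partial>S/\<partial>X\<close> and from the factor \<open>\<epsilon>\<close> in
  front of \<open>I d'/d\<close>, and so do the displacements of \<open>h\<close> caused by the change of \<open>\<partial>g/\<partial>p\<close>.\<close>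

lemma defect_step:
  assumes c: "\<And>i. c i \<in> coeffs" and h: "\<And>i. h i \<in> coeffs" and S: "S \<in> coeffs" and k: "k \<in> coeffs"
  shows "of_order (Suc (Suc n)) (\<lambda>\<epsilon> z.
    defect d \<epsilon> (\<lambda>z. epoly c n \<epsilon> z + \<epsilon> ^ n * S z) (\<lambda>z. epoly h m \<epsilon> z + \<epsilon> ^ Suc n * k z) z
    - defect d \<epsilon> (epoly c n \<epsilon>) (epoly h m \<epsilon>) z
    - \<epsilon> ^ Suc n * (2 * inv_width_sq z * (\<lambda>(J, s, p, X). J) z * D e_angle S z - k z))"
proof -
  let ?I = "\<lambda>(J, s, p, X). J" and ?p = "\<lambda>(J, s, p, X). p"
  let ?g = "epoly c n"
  \<comment> \<open>\<open>?B\<close>, \<open>?Q\<close> and \<open>?K\<close> collect the higher-order terms from the explicit part, from displacing the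
    old \<open>h\<close> and from displacing the new one.\<close>
  let ?B = "\<lambda>\<epsilon> z. inv_width_sq z * (2 * D e_angle (?g \<epsilon>) z * D e_angle S z + \<epsilon> ^ n * (D e_angle S z)\<^sup>2)
    + 2 * (?p z + \<epsilon>\<^sup>2 * D e_coord (?g \<epsilon>) z - \<epsilon> * (?I z + \<epsilon> * D e_angle (?g \<epsilon>) z) * slope z)
        * (D e_coord S z - D e_angle S z * slope z)
    + \<epsilon> ^ (n + 2) * (D e_coord S z - D e_angle S z * slope z)\<^sup>2"
  let ?T = "\<lambda>\<epsilon> z. D e_momentum (?g \<epsilon>) z + \<epsilon> ^ n * D e_momentum S z"
  let ?Q = "\<lambda>\<epsilon> z. \<Sum>i<m. \<epsilon> ^ i * (shift (h i) (\<epsilon>\<^sup>2 * D e_momentum (?g \<epsilon>) z + \<epsilon> ^ (n + 2) * D e_momentum S z) z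
      - shift (h i) (\<epsilon>\<^sup>2 * D e_momentum (?g \<epsilon>) z) z)"
  let ?K = "\<lambda>\<epsilon> z. \<epsilon> ^ Suc n * (shift k (0 + \<epsilon> ^ 2 * ?T \<epsilon> z) z - shift k 0 z)"
  have "of_order 0 ?B"
    by (rule expands_imp_of_order[of 0])
      (intro expands_diff expands_add expands_mult expands_power expands_eps expands_eps_power
        expands_D_epoly c S expands_coeffs inv_width_sq_coeffs slope_coeffs coeffs_intros)
  then have B: "of_order (n + 2) (\<lambda>\<epsilon> z. \<epsilon> ^ (n + 2) * ?B \<epsilon> z)"
    using of_order_power_mult[of 0 _ "n + 2"] by simp
  have "of_order 0 ?T"
    by (rule expands_imp_of_order[of 0])
      (intro expands_add expands_mult expands_eps_power expands_D_epoly c S expands_coeffs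
        coeffs_intros)
  from of_order_power_mult[OF of_order_shift_increment[OF k this, of 2 "\<lambda>\<epsilon> z. 0"], of "Suc n"]
  have K: "of_order (n + 2) ?K"
    by (rule of_order_mono) simp
  have Q: "of_order (n + 2) ?Q"
  proof (rule of_order_sum)
    fix i
    have "of_order (n + 2) (\<lambda>\<epsilon> z.
        shift (h i) (\<epsilon>\<^sup>2 * D e_momentum (?g \<epsilon>) z + \<epsilon> ^ (n + 2) * D e_momentum S z) z
        - shift (h i) (\<epsilon>\<^sup>2 * D e_momentum (?g \<epsilon>) z) z)"
      by (rule of_order_shift_increment[OF h of_order_coeffs[OF D_coeffs[OF S]]])
    from of_order_mono[OF of_order_power_mult[OF this, of i]]
    show "of_order (n + 2) (\<lambda>\<epsilon> z. \<epsilon> ^ i *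
        (shift (h i) (\<epsilon>\<^sup>2 * D e_momentum (?g \<epsilon>) z + \<epsilon> ^ (n + 2) * D e_momentum S z) z
        - shift (h i) (\<epsilon>\<^sup>2 * D e_momentum (?g \<epsilon>) z) z))"
      by simp
  qed
  have "of_order (n + 2) (\<lambda>\<epsilon> z. \<epsilon> ^ (n + 2) * ?B \<epsilon> z - ?Q \<epsilon> z - ?K \<epsilon> z)"
    by (intro of_order_diff B Q K)
  moreover have "defect d \<epsilon> (\<lambda>z. ?g \<epsilon> z + \<epsilon> ^ n * S z) (\<lambda>z. epoly h m \<epsilon> z + \<epsilon> ^ Suc n * k z) z
      - defect d \<epsilon> (?g \<epsilon>) (epoly h m \<epsilon>) z
      - \<epsilon> ^ Suc n * (2 * inv_width_sq z * ?I z * D e_angle S z - k z)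
      = \<epsilon> ^ (n + 2) * ?B \<epsilon> z - ?Q \<epsilon> z - ?K \<epsilon> z" if "0 < fst z" for \<epsilon> z
  proof -
    define a b t \<sigma> \<xi> \<tau> w \<kappa> I p where abbrs: "a = D e_angle (?g \<epsilon>) z" "b = D e_coord (?g \<epsilon>) z"
      "t = D e_momentum (?g \<epsilon>) z" "\<sigma> = D e_angle S z" "\<xi> = D e_coord S z" "\<tau> = D e_momentum S z"
      "w = inv_width_sq z" "\<kappa> = slope z" "I = ?I z" "p = ?p z"
    have D: "D v (\<lambda>z. ?g \<epsilon> z + \<epsilon> ^ n * S z) z = D v (?g \<epsilon>) z + \<epsilon> ^ n * D v S z" for v
      by (rule D_scale_add[OF epoly_coeffs[OF c] S that])
    have sh: "shift (\<lambda>z. epoly h m \<epsilon> z + \<epsilon> ^ Suc n * k z) y z =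
        shift (epoly h m \<epsilon>) y z + \<epsilon> ^ Suc n * shift k y z" for y
      by (simp add: shift_def case_prod_beta)
    have Q: "?Q \<epsilon> z = shift (epoly h m \<epsilon>) (\<epsilon>\<^sup>2 * (t + \<epsilon> ^ n * \<tau>)) z - shift (epoly h m \<epsilon>) (\<epsilon>\<^sup>2 * t) z"
      unfolding abbrs shift_epoly sum_subtractf[symmetric] right_diff_distrib
      by (simp add: power_add power2_eq_square algebra_simps)
    have M: "w * (I + \<epsilon> * (a + \<epsilon> ^ n * \<sigma>))\<^sup>2
        + (p + \<epsilon>\<^sup>2 * (b + \<epsilon> ^ n * \<xi>) - \<epsilon> * (I + \<epsilon> * (a + \<epsilon> ^ n * \<sigma>)) * \<kappa>)\<^sup>2 - 1
        - (w * (I + \<epsilon> * a)\<^sup>2 + (p + \<epsilon>\<^sup>2 * b - \<epsilon> * (I + \<epsilon> * a) * \<kappa>)\<^sup>2 - 1)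
        - \<epsilon> ^ Suc n * (2 * w * I * \<sigma>)
        = \<epsilon> ^ (n + 2) * (w * (2 * a * \<sigma> + \<epsilon> ^ n * \<sigma>\<^sup>2)
          + 2 * (p + \<epsilon>\<^sup>2 * b - \<epsilon> * (I + \<epsilon> * a) * \<kappa>) * (\<xi> - \<sigma> * \<kappa>) + \<epsilon> ^ (n + 2) * (\<xi> - \<sigma> * \<kappa>)\<^sup>2)"
      by (simp add: power_add) algebra
    show ?thesis
      unfolding defect_def mixed_ham_eq D sh Q shift_0 using M
      unfolding abbrs[symmetric] by (simp add: algebra_simps)
  qed
  ultimately have "of_order (n + 2) (\<lambda>\<epsilon> z.
      defect d \<epsilon> (\<lambda>z. epoly c n \<epsilon> z + \<epsilon> ^ n * S z) (\<lambda>z. epoly h m \<epsilon> z + \<epsilon> ^ Suc n * k z) z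
      - defect d \<epsilon> (epoly c n \<epsilon>) (epoly h m \<epsilon>) z
      - \<epsilon> ^ Suc n * (2 * inv_width_sq z * ?I z * D e_angle S z - k z))"
    by (rule of_order_cong) simp
  then show ?thesis by simp
qed

text \<open>With \<open>A\<close> a primitive of \<open>a\<close> in \<open>s\<close> and \<open>k\<close> the mean of \<open>a\<close> over \<open>[-\<pi>, \<pi>]\<close>, the function
  \<open>S = d\<^sup>2 / (2\<pi>\<^sup>2J) (s k - A)\<close> solves the equation, and subtracting the mean makes its values at
  \<open>s = \<plusminus>\<pi>\<close> agree.\<close>

lemma homological_equation:
  assumes "a \<in> coeffs"
  obtains S k where "S \<in> coeffs" "angle_periodic S" "k \<in> coeffs" "angle_free k"
    "\<And>z. 0 < fst z \<Longrightarrow> a z + (2 * inv_width_sq z * (\<lambda>(J, s, p, X). J) z * D e_angle S z - k z) = 0"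
proof -
  obtain A where A: "A \<in> coeffs" "\<And>z. 0 < fst z \<Longrightarrow> D e_angle A z = a z"
    using angle_antiderivative[OF assms] by blast
  define k :: "phase \<Rightarrow> real" where "k = (\<lambda>z. inverse (2 * pi) *
    ((\<lambda>(J, s, p, X). A (J, pi, p, X)) z - (\<lambda>(J, s, p, X). A (J, - pi, p, X)) z))"
  define w :: "phase \<Rightarrow> real" where "w = (\<lambda>z. inverse (2 * pi\<^sup>2) *
    ((\<lambda>(J, s, p, X). (deriv ^^ 0) d X) z)\<^sup>2 * (\<lambda>(J, s, p, X). inverse J) z)"
  define S where "S = (\<lambda>z. w z * ((\<lambda>(J, s, p, X). s) z * k z - A z))"
  have k: "k \<in> coeffs"
    unfolding k_def by (intro coeffs_intros coeffs_at_angle A)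
  have w: "w \<in> coeffs"
    unfolding w_def by (intro coeffs_intros)
  have S: "S \<in> coeffs"
    unfolding S_def by (intro coeffs_intros k w A)
  show ?thesis
  proof (rule that[OF S _ k])
    show "angle_free k"
      by (simp add: angle_free_def k_def)
    show "angle_periodic S"
      by (simp add: angle_periodic_def S_def w_def k_def field_simps)
    fix z :: phase assume "0 < fst z"
    then obtain J s p X where z: "z = (J, s, p, X)" "0 < J" by (cases z) auto
    have "((\<lambda>s. w (J, 0, p, X) * (s * k (J, 0, p, X) - A (J, s, p, X))) has_field_derivative
        w (J, 0, p, X) * (k (J, 0, p, X) - a (J, s, p, X))) (at s)"
      using coeffs_partial(2)[OF A(1) z(2), where s = s and p = p and X = X] A(2)[of "(J, s, p, X)"] z(2)
      by (auto intro!: derivative_eq_intros)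
    then have "((\<lambda>s. S (J, s, p, X)) has_field_derivative
        w (J, 0, p, X) * (k (J, 0, p, X) - a (J, s, p, X))) (at s)"
      by (simp add: S_def w_def k_def)
    from DERIV_unique[OF coeffs_partial(2)[OF S z(2)] this]
    show "a z + (2 * inv_width_sq z * (\<lambda>(J, s, p, X). J) z * D e_angle S z - k z) = 0"
      using z by (simp add: w_def k_def field_simps)
  qed
qed

abbreviation unperturbed :: "phase \<Rightarrow> real" where
  "unperturbed \<equiv> \<lambda>(J, s, p, X). pi\<^sup>2 * J\<^sup>2 / (d X)\<^sup>2 + p\<^sup>2 - 1"

lemma unperturbed_coeffs: "unperturbed \<in> coeffs"
proof (rule coeffs.agree)
  show "(\<lambda>z. inv_width_sq z * ((\<lambda>(J, s, p, X). J) z)\<^sup>2 + ((\<lambda>(J, s, p, X). p) z)\<^sup>2 - 1) \<in> coeffs"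
    by (intro coeffs_intros)
qed (auto simp: divide_inverse power_inverse)

lemma of_order_defect_0:
  assumes "h 0 = unperturbed"
  shows "of_order 1 (\<lambda>\<epsilon>. defect d \<epsilon> (epoly c 0 \<epsilon>) (epoly h 1 \<epsilon>))"
proof -
  have "of_order (1 + 0) (\<lambda>\<epsilon> z. \<epsilon> ^ 1 * (\<epsilon> * ((\<lambda>(J, s, p, X). J) z * slope z)\<^sup>2
      - 2 * (\<lambda>(J, s, p, X). p) z * ((\<lambda>(J, s, p, X). J) z * slope z)))"
    by (rule of_order_power_mult, rule expands_imp_of_order[of 0])
      (intro expands_diff expands_mult expands_eps expands_coeffs expands_power coeffs_intros slope_coeffs)
  then show ?thesis
    unfolding add_0_right
  proof (rule of_order_cong)
    fix \<epsilon> J s p X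
    show "defect d \<epsilon> (epoly c 0 \<epsilon>) (epoly h 1 \<epsilon>) (J, s, p, X) =
      \<epsilon> ^ 1 * (\<epsilon> * ((\<lambda>(J, s, p, X). J) (J, s, p, X) * slope (J, s, p, X))\<^sup>2
      - 2 * (\<lambda>(J, s, p, X). p) (J, s, p, X) * ((\<lambda>(J, s, p, X). J) (J, s, p, X) * slope (J, s, p, X)))"
      by (simp add: defect_def mixed_ham_def epoly_0 epoly_Suc shift_0 assms Let_def power2_eq_square
          divide_inverse algebra_simps)
  qed
qed

text \<open>Indices are shifted by one: \<open>c i\<close> is the term \<open>S\<close> with index \<open>i + 1\<close>, while \<open>h 0\<close> is the
  unperturbed Hamiltonian and \<open>h i\<close> the correction of order \<open>i\<close>.\<close>

theorem normal_form:
  "\<exists>c h. (\<forall>i. c i \<in> coeffs \<and> angle_periodic (c i)) \<and> (\<forall>i. h i \<in> coeffs \<and> angle_free (h i)) \<and>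
    h 0 = unperturbed \<and> of_order (Suc n) (\<lambda>\<epsilon>. defect d \<epsilon> (epoly c n \<epsilon>) (epoly h (Suc n) \<epsilon>))"
proof (induction n)
  case 0
  let ?h = "\<lambda>i::nat. if i = 0 then unperturbed else (\<lambda>z. 0)" and ?c = "\<lambda>(i::nat) (z::phase). 0::real"
  have "of_order 1 (\<lambda>\<epsilon>. defect d \<epsilon> (epoly ?c 0 \<epsilon>) (epoly ?h 1 \<epsilon>))"
    by (rule of_order_defect_0) simp
  then show ?case
    by - (rule exI[of _ ?c], rule exI[of _ ?h],
        auto simp: angle_periodic_def angle_free_def unperturbed_coeffs coeffs.const)
next
  case (Suc n)
  then obtain c h where c: "\<And>i. c i \<in> coeffs" "\<And>i. angle_periodic (c i)"
    and h: "\<And>i. h i \<in> coeffs" "\<And>i. angle_free (h i)" "h 0 = unperturbed"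
    and small: "of_order (Suc n) (\<lambda>\<epsilon>. defect d \<epsilon> (epoly c n \<epsilon>) (epoly h (Suc n) \<epsilon>))"
    by blast
  obtain a where a: "a \<in> coeffs"
    "of_order (Suc (Suc n)) (\<lambda>\<epsilon> z. defect d \<epsilon> (epoly c n \<epsilon>) (epoly h (Suc n) \<epsilon>) z - \<epsilon> ^ Suc n * a z)"
    using expands_leading_term[OF expands_defect[OF c(1) h(1)] small] by blast
  obtain S k where S: "S \<in> coeffs" "angle_periodic S" and k: "k \<in> coeffs" "angle_free k"
    and eq: "\<And>z. 0 < fst z \<Longrightarrow> a z + (2 * inv_width_sq z * (\<lambda>(J, s, p, X). J) z * D e_angle S z - k z) = 0"
    using homological_equation[OF a(1)] by blast
  let ?c = "c(n := S)" and ?h = "h(Suc n := k)"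
  have cn: "epoly ?c (Suc n) = (\<lambda>\<epsilon> z. epoly c n \<epsilon> z + \<epsilon> ^ n * S z)"
    using epoly_cong[where n = n and c = ?c and c' = c] by (simp add: epoly_Suc fun_eq_iff)
  have hn: "epoly ?h (Suc (Suc n)) = (\<lambda>\<epsilon> z. epoly h (Suc n) \<epsilon> z + \<epsilon> ^ Suc n * k z)"
    using epoly_cong[where n = "Suc n" and c = ?h and c' = h] by (simp add: epoly_Suc[where n = "Suc n"] fun_eq_iff)
  have "of_order (Suc (Suc n)) (\<lambda>\<epsilon>. defect d \<epsilon> (epoly ?c (Suc n) \<epsilon>) (epoly ?h (Suc (Suc n)) \<epsilon>))"
  proof (rule of_order_cong[OF of_order_add[OF a(2) defect_step[where n = n and m = "Suc n", OF c(1) h(1) S(1) k(1)]]])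
    fix \<epsilon> J s p X assume "0 < (J::real)"
    then have "\<epsilon> ^ Suc n * (a (J, s, p, X) + (2 * inv_width_sq (J, s, p, X) * J * D e_angle S (J, s, p, X) - k (J, s, p, X))) = 0"
      using eq[of "(J, s, p, X)"] by simp
    then show "defect d \<epsilon> (epoly ?c (Suc n) \<epsilon>) (epoly ?h (Suc (Suc n)) \<epsilon>) (J, s, p, X) =
      defect d \<epsilon> (epoly c n \<epsilon>) (epoly h (Suc n) \<epsilon>) (J, s, p, X) - \<epsilon> ^ Suc n * a (J, s, p, X) +
      (defect d \<epsilon> (\<lambda>z. epoly c n \<epsilon> z + \<epsilon> ^ n * S z) (\<lambda>z. epoly h (Suc n) \<epsilon> z + \<epsilon> ^ Suc n * k z) (J, s, p, X)
        - defect d \<epsilon> (epoly c n \<epsilon>) (epoly h (Suc n) \<epsilon>) (J, s, p, X)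
        - \<epsilon> ^ Suc n * (2 * inv_width_sq (J, s, p, X) * (\<lambda>(J, s, p, X). J) (J, s, p, X) * D e_angle S (J, s, p, X)
            - k (J, s, p, X)))"
      unfolding cn hn distrib_left by simp
  qed
  then show ?case
    using c h S k by - (rule exI[of _ ?c], rule exI[of _ ?h], auto simp: fun_upd_def)
qed

end

section \<open>The saw-tooth function\<close>

lemma saw_range: "- pi \<le> saw \<phi>" "saw \<phi> < pi"
proof -
  let ?y = "(\<phi> + pi) / (2 * pi)"
  have "of_int \<lfloor>?y\<rfloor> \<le> ?y" "?y < of_int \<lfloor>?y\<rfloor> + 1"
    by linarith+
  then have "of_int \<lfloor>?y\<rfloor> * (2 * pi) \<le> \<phi> + pi" "\<phi> + pi < (of_int \<lfloor>?y\<rfloor> + 1) * (2 * pi)"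
    using iffD1[OF pos_le_divide_eq[of "2 * pi"]] iffD1[OF pos_divide_less_eq[of "2 * pi"]]
    by (meson mult_pos_pos pi_gt_zero zero_less_numeral)+
  then show "- pi \<le> saw \<phi>" "saw \<phi> < pi"
    by (simp_all add: saw_def algebra_simps)
qed

lemma saw_unique:
  assumes "- pi \<le> \<phi> - 2 * pi * of_int k" "\<phi> - 2 * pi * of_int k < pi"
  shows "saw \<phi> = \<phi> - 2 * pi * of_int k"
proof -
  have "\<lfloor>(\<phi> + pi) / (2 * pi)\<rfloor> = k"
    using assms by (simp add: floor_eq_iff field_simps)
  then show ?thesis by (simp add: saw_def)
qed

lemma regular_angle_iff: "\<phi> \<in> regular_angles \<longleftrightarrow> - pi < saw \<phi>"
proof
  assume "\<phi> \<in> regular_angles"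
  then have "\<phi> \<noteq> (2 * of_int (\<lfloor>(\<phi> + pi) / (2 * pi)\<rfloor> - 1) + 1) * pi"
    unfolding regular_angles_def by blast
  then have "saw \<phi> \<noteq> - pi"
    by (simp add: saw_def algebra_simps)
  then show "- pi < saw \<phi>"
    using saw_range[of \<phi>] by simp
next
  assume *: "- pi < saw \<phi>"
  show "\<phi> \<in> regular_angles"
    unfolding regular_angles_def
  proof (intro CollectI allI notI)
    fix k :: int assume "\<phi> = (2 * of_int k + 1) * pi"
    then have "saw \<phi> = \<phi> - 2 * pi * of_int (k + 1)"
      by (intro saw_unique) (simp_all add: algebra_simps)
    then show False
      using * \<open>\<phi> = _\<close> by (simp add: algebra_simps)
  qed
qed

lemma saw_near_regular:
  assumes "\<phi> \<in> regular_angles"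
  obtains k :: int where "\<phi> \<in> {2 * pi * of_int k - pi<..<2 * pi * of_int k + pi}"
    "\<And>\<psi>. \<psi> \<in> {2 * pi * of_int k - pi<..<2 * pi * of_int k + pi} \<Longrightarrow>
      saw \<psi> = \<psi> - 2 * pi * of_int k \<and> \<psi> \<in> regular_angles"
proof -
  let ?k = "\<lfloor>(\<phi> + pi) / (2 * pi)\<rfloor>"
  have "\<phi> \<in> {2 * pi * of_int ?k - pi<..<2 * pi * of_int ?k + pi}"
    using assms[unfolded regular_angle_iff] saw_range(2)[of \<phi>] unfolding saw_def by auto
  moreover have "saw \<psi> = \<psi> - 2 * pi * of_int ?k \<and> \<psi> \<in> regular_angles"
    if "\<psi> \<in> {2 * pi * of_int ?k - pi<..<2 * pi * of_int ?k + pi}" for \<psi>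
  proof -
    have "saw \<psi> = \<psi> - 2 * pi * of_int ?k"
      by (rule saw_unique) (use that in auto)
    then show ?thesis using that by (simp add: regular_angle_iff)
  qed
  ultimately show ?thesis using that by blast
qed

lemma open_regular_angles: "open regular_angles"
proof (subst open_subopen, intro ballI)
  fix \<phi> assume "\<phi> \<in> regular_angles"
  then obtain k :: int where "\<phi> \<in> {2 * pi * of_int k - pi<..<2 * pi * of_int k + pi}"
    "\<And>\<psi>. \<psi> \<in> {2 * pi * of_int k - pi<..<2 * pi * of_int k + pi} \<Longrightarrow> \<psi> \<in> regular_angles"
    using saw_near_regular by metis
  then show "\<exists>T. open T \<and> \<phi> \<in> T \<and> T \<subseteq> regular_angles"
    by (intro exI[of _ "{2 * pi * of_int k - pi<..<2 * pi * of_int k + pi}"]) auto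
qed

lemma DERIV_saw: "\<phi> \<in> regular_angles \<Longrightarrow> (saw has_field_derivative 1) (at \<phi>)"
proof -
  assume "\<phi> \<in> regular_angles"
  then obtain k :: int where k: "\<phi> \<in> {2 * pi * of_int k - pi<..<2 * pi * of_int k + pi}"
    "\<And>\<psi>. \<psi> \<in> {2 * pi * of_int k - pi<..<2 * pi * of_int k + pi} \<Longrightarrow>
      saw \<psi> = \<psi> - 2 * pi * of_int k"
    using saw_near_regular by metis
  have "((\<lambda>\<psi>. \<psi> - 2 * pi * of_int k) has_field_derivative 1) (at \<phi>)"
    by (auto intro!: derivative_eq_intros)
  from has_field_derivative_transform_within_open[OF this _ k(1), of saw] show ?thesis
    using k(2) by simp
qed

text \<open>If the two points lie in the same period, \<^const>\<open>saw\<close> is a translation. In adjacent periods the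
  path goes through the jump, where the values match. Further apart, the distance of
  the angles is at least the length of the interval.\<close>

lemma lipschitz_saw:
  assumes lip: "\<And>s s'. s \<in> {-pi..pi} \<Longrightarrow> s' \<in> {-pi..pi} \<Longrightarrow> \<bar>v s - v s'\<bar> \<le> L * \<bar>s - s'\<bar>"
    and per: "v pi = v (- pi :: real)"
  shows "\<bar>v (saw a) - v (saw b)\<bar> \<le> L * \<bar>a - b\<bar>"
proof -
  have L: "0 \<le> L"
    using lip[of 0 1] pi_ge_two by (simp add: abs_if split: if_splits)
  have main: "\<bar>v (saw a) - v (saw b)\<bar> \<le> L * \<bar>a - b\<bar>" if "a \<le> b" for a b
  proof -
    define k l where "k = \<lfloor>(a + pi) / (2 * pi)\<rfloor>" and "l = \<lfloor>(b + pi) / (2 * pi)\<rfloor>"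
    have sa: "saw a = a - 2 * pi * of_int k" and sb: "saw b = b - 2 * pi * of_int l"
      by (simp_all add: saw_def k_def l_def)
    have ra: "saw a \<in> {-pi..pi}" "saw b \<in> {-pi..pi}"
      using saw_range[of a] saw_range[of b] by auto
    have "k \<le> l"
      unfolding k_def l_def using that by (intro floor_mono divide_right_mono) auto
    then consider "k = l" | "l = k + 1" | "k + 2 \<le> l" by linarith
    then show ?thesis
    proof cases
      case 1
      then show ?thesis using lip[OF ra] sa sb by simp
    next
      case 2
      have "\<bar>v (saw a) - v (saw b)\<bar> \<le> \<bar>v (saw a) - v pi\<bar> + \<bar>v (- pi) - v (saw b)\<bar>"
        using per by linarith
      also have "\<dots> \<le> L * \<bar>saw a - pi\<bar> + L * \<bar>- pi - saw b\<bar>"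
        using ra by (intro add_mono lip) auto
      also have "\<dots> = L * ((pi - saw a) + (saw b + pi))"
      proof -
        have "\<bar>saw a - pi\<bar> = pi - saw a" "\<bar>- pi - saw b\<bar> = saw b + pi"
          using ra by auto
        then show ?thesis by (simp only: distrib_left)
      qed
      also have "(pi - saw a) + (saw b + pi) = \<bar>a - b\<bar>"
        using that 2 sa sb by (simp add: algebra_simps)
      finally show ?thesis .
    next
      case 3
      have "2 * pi * 2 \<le> 2 * pi * of_int (l - k)"
        using 3 by (intro mult_left_mono) auto
      then have "2 * pi \<le> \<bar>a - b\<bar>"
        using sa sb ra that by (simp add: algebra_simps)
      have "\<bar>v (saw a) - v (saw b)\<bar> \<le> L * \<bar>saw a - saw b\<bar>"
        using ra by (intro lip) auto
      also have "\<dots> \<le> L * \<bar>a - b\<bar>"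
        using ra \<open>2 * pi \<le> \<bar>a - b\<bar>\<close> L by (intro mult_left_mono) auto
      finally show ?thesis .
    qed
  qed
  show ?thesis
    using main[of a b] main[of b a] by (cases "a \<le> b") (simp_all add: abs_minus_commute)
qed

section \<open>Small perturbations of the identity\<close>

text \<open>It serves for differences of points, where it gives injectivity of the map to the old variables,
  and for kernel vectors of the differentials.\<close>

lemma small_coupling_imp_zero:
  fixes a c k :: real
  assumes "\<bar>a\<bar> \<le> k * (\<bar>a\<bar> + \<bar>c\<bar>)" "\<bar>c\<bar> \<le> k * (\<bar>a\<bar> + \<bar>c\<bar>)" "4 * k \<le> 1"
  shows "a = 0 \<and> c = 0"
proof -
  define y where "y = k * (\<bar>a\<bar> + \<bar>c\<bar>)"
  have "4 * y \<le> 1 * (\<bar>a\<bar> + \<bar>c\<bar>)"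
    unfolding y_def mult.assoc[symmetric] using assms(3) by (intro mult_right_mono) auto
  then have "\<bar>a\<bar> + \<bar>c\<bar> \<le> 0"
    using assms(1,2) unfolding y_def[symmetric] by simp
  then show ?thesis by (intro conjI) linarith+
qed

text \<open>The unique solution is the fixed point of \<open>(\<phi>, x) \<mapsto> (\<psi> - \<epsilon>a, y - \<epsilon>b)\<close>, a contraction with
  constant \<open>1/2\<close>: each component contributes \<open>\<epsilon>L\<close> times the sum norm, which is bounded by twice the
  Euclidean norm, so that the constant is at most \<open>4\<epsilon>L\<close>.\<close>

lemma perturbed_identity_bijective:
  fixes a b :: "real \<Rightarrow> real \<Rightarrow> real"
  assumes "\<And>\<phi> \<phi>' x x'. \<bar>a \<phi> x - a \<phi>' x'\<bar> \<le> L * (\<bar>\<phi> - \<phi>'\<bar> + \<bar>x - x'\<bar>)"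
    and "\<And>\<phi> \<phi>' x x'. \<bar>b \<phi> x - b \<phi>' x'\<bar> \<le> L * (\<bar>\<phi> - \<phi>'\<bar> + \<bar>x - x'\<bar>)"
    and "0 < \<epsilon>" "8 * (\<epsilon> * L) \<le> 1" "0 \<le> L"
  shows "\<exists>!q. (fst q + \<epsilon> * a (fst q) (snd q), snd q + \<epsilon> * b (fst q) (snd q)) = (\<psi>, y)"
proof -
  let ?T = "\<lambda>q. (\<psi> - \<epsilon> * a (fst q) (snd q), y - \<epsilon> * b (fst q) (snd q))"
  have "\<exists>!q. ?T q = q"
  proof (rule banach_fix_type[of "1 / 2"], simp, simp, intro allI)
    fix q q' :: "real \<times> real"
    let ?\<delta> = "\<bar>fst q - fst q'\<bar> + \<bar>snd q - snd q'\<bar>"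
    have "?\<delta> \<le> 2 * dist q q'"
      using dist_fst_le[of q q'] dist_snd_le[of q q'] by (simp add: dist_real_def)
    have "dist (?T q) (?T q') \<le>
        \<bar>\<epsilon> * (a (fst q) (snd q) - a (fst q') (snd q'))\<bar> + \<bar>\<epsilon> * (b (fst q) (snd q) - b (fst q') (snd q'))\<bar>"
      using sqrt_sum_squares_le_sum_abs[of
          "\<epsilon> * (a (fst q) (snd q) - a (fst q') (snd q'))" "\<epsilon> * (b (fst q) (snd q) - b (fst q') (snd q'))"]
      by (simp add: dist_Pair_Pair dist_real_def right_diff_distrib power2_commute)
    also have "\<dots> \<le> \<epsilon> * (L * ?\<delta>) + \<epsilon> * (L * ?\<delta>)"
      unfolding abs_mult using assms(1,2,3) by (intro add_mono mult_mono) auto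
    also have "\<dots> = 2 * (\<epsilon> * L) * ?\<delta>"
      by simp
    also have "\<dots> \<le> 2 * (\<epsilon> * L) * (2 * dist q q')"
      using \<open>?\<delta> \<le> 2 * dist q q'\<close> assms(3,5) by (intro mult_left_mono) auto
    also have "\<dots> \<le> 1 / 2 * dist q q'"
      using mult_right_mono[OF assms(4), of "dist q q'"] by simp
    finally show "dist (?T q) (?T q') \<le> 1 / 2 * dist q q'" .
  qed
  moreover have "?T q = q \<longleftrightarrow>
      (fst q + \<epsilon> * a (fst q) (snd q), snd q + \<epsilon> * b (fst q) (snd q)) = (\<psi>, y)" for q
    by (cases q) auto
  ultimately show ?thesis by simp
qed

section \<open>The canonical change generated by a coefficient function\<close>

definition generator :: "real \<Rightarrow> (phase \<Rightarrow> real) \<Rightarrow> genfun" where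
  "generator \<epsilon> g J \<phi> p x = J * \<phi> + p * x + \<epsilon> * g (J, saw \<phi>, p, \<epsilon> * x)"

abbreviation axes :: "phase set" where
  "axes \<equiv> {e_action, e_angle, e_momentum, e_coord}"

definition derivatives_bounded :: "(phase \<Rightarrow> real) \<Rightarrow> real \<Rightarrow> real \<Rightarrow> bool" where
  "derivatives_bounded g m L \<longleftrightarrow> (\<forall>v\<in>axes. \<forall>z\<in>phase_box m.
     \<bar>D v g z\<bar> \<le> L \<and> (\<forall>w\<in>axes. \<bar>D v (D w g) z\<bar> \<le> L))"

context waveguide
begin

text \<open>The box is a product, so the variables can be changed one at a time.\<close>

lemma coeffs_lipschitz:
  assumes u: "u \<in> coeffs" and "0 < m"
    and bound: "\<And>v z. v \<in> axes \<Longrightarrow> z \<in> phase_box m \<Longrightarrow> \<bar>D v u z\<bar> \<le> L"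
    and z: "(J, s, p, X) \<in> phase_box m" "(J', s', p', X') \<in> phase_box m"
  shows "\<bar>u (J, s, p, X) - u (J', s', p', X')\<bar> \<le> L * (\<bar>J - J'\<bar> + \<bar>s - s'\<bar> + \<bar>p - p'\<bar> + \<bar>X - X'\<bar>)"
proof -
  have pos: "0 < J" if "J \<in> {inverse m..m}" for J
    using that \<open>0 < m\<close> by (auto intro: less_le_trans[of 0 "inverse m"])
  have mem: "(J, s, p, X) \<in> phase_box m \<longleftrightarrow> J \<in> {inverse m..m} \<and> s \<in> {-pi..pi} \<and> p \<in> {-m..m}"
    for J s p X
    by (auto simp: phase_box_def)
  have J: "\<bar>u (J, s, p, X) - u (J', s, p, X)\<bar> \<le> L * \<bar>J - J'\<bar>"
    unfolding real_norm_def[symmetric]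
    by (rule field_differentiable_bound[where S = "{inverse m..m}" and x = J and y = J' and
          f = "\<lambda>J. u (J, s, p, X)" and f' = "\<lambda>J. D e_action u (J, s, p, X)"])
      (rule convex_real_interval convex_UNIV has_field_derivative_at_within[OF coeffs_partial(1)[OF u]]
        | (use z in \<open>simp add: mem pos bound\<close>))+
  have s: "\<bar>u (J', s, p, X) - u (J', s', p, X)\<bar> \<le> L * \<bar>s - s'\<bar>"
    unfolding real_norm_def[symmetric]
    by (rule field_differentiable_bound[where S = "{-pi..pi}" and x = s and y = s' and
          f = "\<lambda>s. u (J', s, p, X)" and f' = "\<lambda>s. D e_angle u (J', s, p, X)"])
      (rule convex_real_interval convex_UNIV has_field_derivative_at_within[OF coeffs_partial(2)[OF u]]
        | (use z in \<open>simp add: mem pos bound\<close>))+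
  have p: "\<bar>u (J', s', p, X) - u (J', s', p', X)\<bar> \<le> L * \<bar>p - p'\<bar>"
    unfolding real_norm_def[symmetric]
    by (rule field_differentiable_bound[where S = "{-m..m}" and x = p and y = p' and
          f = "\<lambda>p. u (J', s', p, X)" and f' = "\<lambda>p. D e_momentum u (J', s', p, X)"])
      (rule convex_real_interval convex_UNIV has_field_derivative_at_within[OF coeffs_partial(3)[OF u]]
        | (use z in \<open>simp add: mem pos bound\<close>))+
  have X: "\<bar>u (J', s', p', X) - u (J', s', p', X')\<bar> \<le> L * \<bar>X - X'\<bar>"
    unfolding real_norm_def[symmetric]
  proof (rule field_differentiable_bound[where S = UNIV and f' = "\<lambda>X. D e_coord u (J', s', p', X)"])
    fix Y
    have J': "0 < J'" and Y: "(J', s', p', Y) \<in> phase_box m"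
      using z(2) pos by (simp_all add: mem)
    show "((\<lambda>X. u (J', s', p', X)) has_field_derivative D e_coord u (J', s', p', Y)) (at Y)"
      by (rule coeffs_partial(4)[OF u J'])
    show "norm (D e_coord u (J', s', p', Y)) \<le> L"
      unfolding real_norm_def by (rule bound[OF _ Y]) blast
  qed (rule convex_UNIV UNIV_I)+
  have "\<bar>u (J, s, p, X) - u (J', s', p', X')\<bar> \<le>
      \<bar>u (J, s, p, X) - u (J', s, p, X)\<bar> + \<bar>u (J', s, p, X) - u (J', s', p, X)\<bar>
      + \<bar>u (J', s', p, X) - u (J', s', p', X)\<bar> + \<bar>u (J', s', p', X) - u (J', s', p', X')\<bar>"
    by linarith
  also have "\<dots> \<le> L * \<bar>J - J'\<bar> + L * \<bar>s - s'\<bar> + L * \<bar>p - p'\<bar> + L * \<bar>X - X'\<bar>"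
    by (intro add_mono J s p X)
  finally show ?thesis
    by (simp only: distrib_left)
qed

text \<open>The matching holds identically in \<open>J\<close> and \<open>p\<close>, hence can be differentiated in these variables.\<close>

lemma angle_periodic_D:
  assumes "g \<in> coeffs" "angle_periodic g"
  shows "angle_periodic (D e_action g)" "angle_periodic (D e_momentum g)"
proof -
  have "D e_action g (J, pi, p, X) = D e_action g (J, - pi, p, X)"
    "D e_momentum g (J, pi, p, X) = D e_momentum g (J, - pi, p, X)" if "0 < J" for J p X
  proof -
    have "((\<lambda>J. g (J, pi, p, X)) has_field_derivative D e_action g (J, - pi, p, X)) (at J)"
      using has_field_derivative_transform_within_open[OF
          coeffs_partial(1)[OF assms(1) that, where s = "- pi" and p = p and X = X],
          of "{0<..}" "\<lambda>J. g (J, pi, p, X)"] assms(2) that by (simp add: angle_periodic_def)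
    then show "D e_action g (J, pi, p, X) = D e_action g (J, - pi, p, X)"
      by (rule DERIV_unique[OF coeffs_partial(1)[OF assms(1) that]])
    have "(\<lambda>p. g (J, pi, p, X)) = (\<lambda>p. g (J, - pi, p, X))"
      using assms(2) that by (simp add: angle_periodic_def)
    then show "D e_momentum g (J, pi, p, X) = D e_momentum g (J, - pi, p, X)"
      using coeffs_partial(3)[OF assms(1) that, where s = pi and p = p and X = X]
        coeffs_partial(3)[OF assms(1) that, where s = "- pi" and p = p and X = X]
      by (auto intro: DERIV_unique)
  qed
  then show "angle_periodic (D e_action g)" "angle_periodic (D e_momentum g)"
    by (simp_all add: angle_periodic_def)
qed

lemma coeffs_saw_lipschitz:
  assumes u: "u \<in> coeffs" "angle_periodic u" and "0 < m"
    and bound: "\<And>v z. v \<in> axes \<Longrightarrow> z \<in> phase_box m \<Longrightarrow> \<bar>D v u z\<bar> \<le> L"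
    and "J \<in> {inverse m..m}" "p \<in> {-m..m}" "0 \<le> L"
  shows "\<bar>u (J, saw \<phi>, p, X) - u (J, saw \<phi>', p, X')\<bar> \<le> L * (\<bar>\<phi> - \<phi>'\<bar> + \<bar>X - X'\<bar>)"
proof -
  have box: "(J, s, p, X) \<in> phase_box m" if "s \<in> {-pi..pi}" for s X
    using that assms by (simp add: phase_box_def)
  have saw: "saw \<phi> \<in> {-pi..pi}" for \<phi>
    using saw_range[of \<phi>] by simp
  have "0 < J"
    using box_positive_action[OF \<open>0 < m\<close> box[of 0]] by simp
  have "\<bar>u (J, saw \<phi>, p, X) - u (J, saw \<phi>', p, X)\<bar> \<le> L * \<bar>\<phi> - \<phi>'\<bar>"
  proof (rule lipschitz_saw)
    show "\<bar>u (J, s, p, X) - u (J, s', p, X)\<bar> \<le> L * \<bar>s - s'\<bar>" if "s \<in> {-pi..pi}" "s' \<in> {-pi..pi}" for s s'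
      using coeffs_lipschitz[OF u(1) \<open>0 < m\<close> bound box[OF that(1)] box[OF that(2)], of X X] by simp
    show "u (J, pi, p, X) = u (J, - pi, p, X)"
      using u(2) \<open>0 < J\<close> by (simp add: angle_periodic_def)
  qed
  moreover have "\<bar>u (J, saw \<phi>', p, X) - u (J, saw \<phi>', p, X')\<bar> \<le> L * \<bar>X - X'\<bar>"
    using coeffs_lipschitz[OF u(1) \<open>0 < m\<close> bound box[OF saw] box[OF saw], of \<phi>' X \<phi>' X'] by simp
  ultimately show ?thesis
    unfolding distrib_left by linarith
qed

lemma old_map_generator:
  assumes "g \<in> coeffs" "0 < J" "\<phi> \<in> regular_angles"
  shows "old_map (generator \<epsilon> g) (J, \<phi>, p, x) =
    (J + \<epsilon> * D e_angle g (J, saw \<phi>, p, \<epsilon> * x), \<phi>,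
     p + \<epsilon>\<^sup>2 * D e_coord g (J, saw \<phi>, p, \<epsilon> * x), x)"
proof -
  have 1: "((\<lambda>\<phi>. g (J, saw \<phi>, p, \<epsilon> * x)) has_field_derivative
      D e_angle g (J, saw \<phi>, p, \<epsilon> * x) * 1) (at \<phi>)"
    by (rule DERIV_chain2[OF coeffs_partial(2) DERIV_saw]) (use assms in auto)
  have 2: "((\<lambda>x. g (J, saw \<phi>, p, \<epsilon> * x)) has_field_derivative
      D e_coord g (J, saw \<phi>, p, \<epsilon> * x) * \<epsilon>) (at x)"
    by (rule DERIV_chain2[OF coeffs_partial(4)[OF assms(1,2)]]) (auto intro!: derivative_eq_intros)
  have "((\<lambda>\<phi>. generator \<epsilon> g J \<phi> p x) has_field_derivative
      J + \<epsilon> * D e_angle g (J, saw \<phi>, p, \<epsilon> * x)) (at \<phi>)"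
    unfolding generator_def by (auto intro!: derivative_eq_intros 1)
  moreover have "((\<lambda>x. generator \<epsilon> g J \<phi> p x) has_field_derivative
      p + \<epsilon>\<^sup>2 * D e_coord g (J, saw \<phi>, p, \<epsilon> * x)) (at x)"
    unfolding generator_def by (auto intro!: derivative_eq_intros 2 simp: power2_eq_square)
  ultimately show ?thesis
    by (simp add: old_map_def DERIV_imp_deriv)
qed

lemma new_map_generator:
  assumes "g \<in> coeffs" "0 < J"
  shows "new_map (generator \<epsilon> g) (J, \<phi>, p, x) =
    (J, \<phi> + \<epsilon> * D e_action g (J, saw \<phi>, p, \<epsilon> * x),
     p, x + \<epsilon> * D e_momentum g (J, saw \<phi>, p, \<epsilon> * x))"
proof -
  have "((\<lambda>J. generator \<epsilon> g J \<phi> p x) has_field_derivative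
      \<phi> + \<epsilon> * D e_action g (J, saw \<phi>, p, \<epsilon> * x)) (at J)"
    unfolding generator_def by (auto intro!: derivative_eq_intros coeffs_partial(1) assms)
  moreover have "((\<lambda>p. generator \<epsilon> g J \<phi> p x) has_field_derivative
      x + \<epsilon> * D e_momentum g (J, saw \<phi>, p, \<epsilon> * x)) (at p)"
    unfolding generator_def by (auto intro!: derivative_eq_intros coeffs_partial(3) assms)
  ultimately show ?thesis
    by (simp add: new_map_def DERIV_imp_deriv)
qed

text \<open>The map leaves \<open>J\<close> and \<open>p\<close> alone, so bijectivity is a statement about \<open>(\<phi>, x)\<close> for each fixed pair.
  All real angles are allowed, including those at which \<^const>\<open>saw\<close> jumps.\<close>

lemma new_map_generator_bij:
  assumes g: "g \<in> coeffs" "angle_periodic g" and "0 < m"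
    and bounds: "derivatives_bounded g m L"
    and \<epsilon>: "0 < \<epsilon>" "\<epsilon> \<le> 1" "8 * (\<epsilon> * L) \<le> 1" "0 \<le> L"
    and KB: "K \<subseteq> {inverse m..m}" "B \<subseteq> {-m..m}"
  shows "bij_betw (new_map (generator \<epsilon> g)) (K \<times> UNIV \<times> B \<times> UNIV) (K \<times> UNIV \<times> B \<times> UNIV)"
proof -
  have pos: "0 < J" if "J \<in> K" for J
  proof -
    have "0 < inverse m"
      using \<open>0 < m\<close> by simp
    also have "inverse m \<le> J"
      using subsetD[OF KB(1) that] by simp
    finally show ?thesis .
  qed
  have lip: "\<bar>D w g (J, saw \<phi>, p, \<epsilon> * x) - D w g (J, saw \<phi>', p, \<epsilon> * x')\<bar>
      \<le> L * (\<bar>\<phi> - \<phi>'\<bar> + \<bar>x - x'\<bar>)"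
    if w: "w \<in> axes" "angle_periodic (D w g)" and Jp: "J \<in> K" "p \<in> B" for w J p \<phi> \<phi>' x x'
  proof -
    have bound: "\<bar>D v (D w g) z\<bar> \<le> L" if "v \<in> axes" "z \<in> phase_box m" for v z
      using bounds w(1) that unfolding derivatives_bounded_def by blast
    have "\<bar>D w g (J, saw \<phi>, p, \<epsilon> * x) - D w g (J, saw \<phi>', p, \<epsilon> * x')\<bar>
        \<le> L * (\<bar>\<phi> - \<phi>'\<bar> + \<bar>\<epsilon> * x - \<epsilon> * x'\<bar>)"
      by (rule coeffs_saw_lipschitz[OF D_coeffs[OF g(1)] w(2) \<open>0 < m\<close> bound
            subsetD[OF KB(1) Jp(1)] subsetD[OF KB(2) Jp(2)] \<epsilon>(4)])
    also have "\<bar>\<epsilon> * x - \<epsilon> * x'\<bar> \<le> 1 * \<bar>x - x'\<bar>"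
      unfolding right_diff_distrib[symmetric] abs_mult using \<epsilon> by (intro mult_right_mono) auto
    finally show ?thesis using \<open>0 \<le> L\<close> by (simp add: mult_left_mono)
  qed
  have unique: "\<exists>!q. (fst q + \<epsilon> * D e_action g (J, saw (fst q), p, \<epsilon> * snd q),
      snd q + \<epsilon> * D e_momentum g (J, saw (fst q), p, \<epsilon> * snd q)) = (\<psi>, y)"
    if "J \<in> K" "p \<in> B" for J p \<psi> y
    by (rule perturbed_identity_bijective[OF lip[OF _ angle_periodic_D(1)[OF g] that]
          lip[OF _ angle_periodic_D(2)[OF g] that] \<epsilon>(1,3,4)]) blast+
  show ?thesis
    unfolding bij_betw_def
  proof
    show "inj_on (new_map (generator \<epsilon> g)) (K \<times> UNIV \<times> B \<times> UNIV)"
    proof (rule inj_onI)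
      fix z z' assume "z \<in> K \<times> UNIV \<times> B \<times> UNIV" "z' \<in> K \<times> UNIV \<times> B \<times> UNIV"
        and eq0: "new_map (generator \<epsilon> g) z = new_map (generator \<epsilon> g) z'"
      then obtain J \<phi> p x J' \<phi>' p' x' where z: "z = (J, \<phi>, p, x)" "z' = (J', \<phi>', p', x')"
        and J: "J \<in> K" "p \<in> B" "J' \<in> K" "p' \<in> B"
        by (cases z, cases z') auto
      note eq = eq0[unfolded z]
      then have "J' = J" "p' = p"
        using J by (simp_all add: new_map_generator g pos)
      obtain \<psi> y where "new_map (generator \<epsilon> g) (J, \<phi>, p, x) = (J, \<psi>, p, y)"
        using J by (simp add: new_map_generator g pos)
      with eq have "(\<phi>, x) = (\<phi>', x')"
        using J unique[OF J(1,2), of \<psi> y] unfolding \<open>J' = J\<close> \<open>p' = p\<close>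
        by (simp only: new_map_generator g pos prod.inject) (metis fst_conv snd_conv)
      then show "z = z'"
        using z \<open>J' = J\<close> \<open>p' = p\<close> by simp
    qed
    show "new_map (generator \<epsilon> g) ` (K \<times> UNIV \<times> B \<times> UNIV) = K \<times> UNIV \<times> B \<times> UNIV"
    proof
      show "new_map (generator \<epsilon> g) ` (K \<times> UNIV \<times> B \<times> UNIV) \<subseteq> K \<times> UNIV \<times> B \<times> UNIV"
        by (auto simp: new_map_generator g pos)
      show "K \<times> UNIV \<times> B \<times> UNIV \<subseteq> new_map (generator \<epsilon> g) ` (K \<times> UNIV \<times> B \<times> UNIV)"
      proof clarify
        fix J \<psi> p y assume J: "J \<in> K" "p \<in> B"
        obtain q where "(fst q + \<epsilon> * D e_action g (J, saw (fst q), p, \<epsilon> * snd q),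
            snd q + \<epsilon> * D e_momentum g (J, saw (fst q), p, \<epsilon> * snd q)) = (\<psi>, y)"
          using unique[OF J] by blast
        then have "(J, \<psi>, p, y) = new_map (generator \<epsilon> g) (J, fst q, p, snd q)"
          using J by (simp add: new_map_generator g pos)
        then show "(J, \<psi>, p, y) \<in> new_map (generator \<epsilon> g) ` (K \<times> UNIV \<times> B \<times> UNIV)"
          using J by blast
      qed
    qed
  qed
qed

lemma mixed_point_in_box:
  assumes "J \<in> {inverse m..m}" "p \<in> {-m..m}"
  shows "(J, saw \<phi>, p, X) \<in> phase_box m"
  using assms saw_range[of \<phi>] by (simp add: phase_box_def)

text \<open>The map leaves \<open>\<phi>\<close> and \<open>x\<close> alone and is a small perturbation of the identity in \<open>(J, p)\<close>.\<close>

lemma old_map_generator_inj: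
  assumes g: "g \<in> coeffs" and "0 < m"
    and bounds: "derivatives_bounded g m L"
    and \<epsilon>: "0 < \<epsilon>" "\<epsilon> \<le> 1" "8 * (\<epsilon> * L) \<le> 1" "0 \<le> L"
    and KB: "K \<subseteq> {inverse m..m}" "B \<subseteq> {-m..m}"
  shows "inj_on (old_map (generator \<epsilon> g)) (K \<times> regular_angles \<times> B \<times> UNIV)"
proof (rule inj_onI)
  fix z z'
  assume "z \<in> K \<times> regular_angles \<times> B \<times> UNIV" "z' \<in> K \<times> regular_angles \<times> B \<times> UNIV"
    and eq0: "old_map (generator \<epsilon> g) z = old_map (generator \<epsilon> g) z'"
  then obtain J \<phi> p x J' \<phi>' p' x' where z: "z = (J, \<phi>, p, x)" "z' = (J', \<phi>', p', x')"
    and \<phi>: "\<phi> \<in> regular_angles" "\<phi>' \<in> regular_angles"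
    and mem: "J \<in> {inverse m..m}" "p \<in> {-m..m}" "J' \<in> {inverse m..m}" "p' \<in> {-m..m}"
    using KB by (cases z, cases z') (auto simp only: mem_Sigma_iff subset_iff)
  let ?\<zeta> = "(J, saw \<phi>, p, \<epsilon> * x)" and ?\<zeta>' = "(J', saw \<phi>, p', \<epsilon> * x)"
  have box: "?\<zeta> \<in> phase_box m" "?\<zeta>' \<in> phase_box m"
    using mixed_point_in_box mem by blast+
  have pos: "0 < J" "0 < J'"
    using box_positive_action[OF \<open>0 < m\<close>] box by fastforce+
  have eqs: "\<phi>' = \<phi>" "x' = x"
    "J + \<epsilon> * D e_angle g ?\<zeta> = J' + \<epsilon> * D e_angle g (J', saw \<phi>', p', \<epsilon> * x')"
    "p + \<epsilon>\<^sup>2 * D e_coord g ?\<zeta> = p' + \<epsilon>\<^sup>2 * D e_coord g (J', saw \<phi>', p', \<epsilon> * x')"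
    using eq0 unfolding z old_map_generator[OF g pos(1) \<phi>(1)] old_map_generator[OF g pos(2) \<phi>(2)]
      prod.inject by blast+
  note eq = eqs(3,4)[unfolded eqs(1,2)]
  have lip: "\<bar>D w g ?\<zeta>' - D w g ?\<zeta>\<bar> \<le> L * (\<bar>J - J'\<bar> + \<bar>p - p'\<bar>)" if "w \<in> axes" for w
  proof -
    have "\<bar>D v (D w g) z\<bar> \<le> L" if "v \<in> axes" "z \<in> phase_box m" for v z
      using bounds \<open>w \<in> axes\<close> that unfolding derivatives_bounded_def by blast
    from coeffs_lipschitz[OF D_coeffs[OF g] \<open>0 < m\<close> this box(2,1)] show ?thesis
      by (simp add: abs_minus_commute)
  qed
  have "J - J' = 0 \<and> p - p' = 0"
  proof (rule small_coupling_imp_zero)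
    have "J - J' = \<epsilon> * (D e_angle g ?\<zeta>' - D e_angle g ?\<zeta>)"
      using eq(1) by (simp add: algebra_simps)
    then have "\<bar>J - J'\<bar> = \<epsilon> * \<bar>D e_angle g ?\<zeta>' - D e_angle g ?\<zeta>\<bar>"
      using \<epsilon>(1) by (simp add: abs_mult)
    also have "\<dots> \<le> \<epsilon> * (L * (\<bar>J - J'\<bar> + \<bar>p - p'\<bar>))"
      using \<epsilon>(1) by (intro mult_left_mono lip) auto
    finally show "\<bar>J - J'\<bar> \<le> \<epsilon> * L * (\<bar>J - J'\<bar> + \<bar>p - p'\<bar>)"
      by (simp only: mult.assoc)
    have "p - p' = \<epsilon>\<^sup>2 * (D e_coord g ?\<zeta>' - D e_coord g ?\<zeta>)"
      using eq(2) by (simp add: algebra_simps)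
    then have "\<bar>p - p'\<bar> = \<epsilon>\<^sup>2 * \<bar>D e_coord g ?\<zeta>' - D e_coord g ?\<zeta>\<bar>"
      by (simp add: abs_mult)
    also have "\<dots> \<le> \<epsilon> * (L * (\<bar>J - J'\<bar> + \<bar>p - p'\<bar>))"
      using \<epsilon> by (intro mult_mono lip) (auto simp: power2_eq_square mult_left_le)
    finally show "\<bar>p - p'\<bar> \<le> \<epsilon> * L * (\<bar>J - J'\<bar> + \<bar>p - p'\<bar>)"
      by (simp only: mult.assoc)
  qed (use \<epsilon> in simp)
  then show "z = z'"
    using z eqs(1,2) by simp
qed

lemma bij_if_trivial_kernel:
  fixes A :: "phase \<Rightarrow> phase"
  assumes "linear A" "\<And>v. A v = 0 \<Longrightarrow> v = 0"
  shows "bij A"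
proof -
  have "inj A"
    using assms linear_injective_0 by blast
  then show ?thesis
    using linear_injective_imp_surjective[OF assms(1)] by (simp add: bij_def)
qed

text \<open>Off the jumps, \<^const>\<open>saw\<close> has derivative 1, so the second derivatives of the generating function are
  those of \<open>g\<close>, with a factor \<open>\<epsilon>\<close> for each differentiation in \<open>x\<close>. Expanding the two
  symplectic forms in these entries, they differ only by antisymmetrised second derivatives.\<close>

lemma canonical_at_generator:
  assumes g: "g \<in> coeffs" and "0 < m"
    and bounds: "derivatives_bounded g m L"
    and \<epsilon>: "0 < \<epsilon>" "\<epsilon> \<le> 1" "8 * (\<epsilon> * L) \<le> 1" "0 \<le> L"
    and mem: "J \<in> {inverse m..m}" "p \<in> {-m..m}" "\<phi> \<in> regular_angles"
  shows "canonical_at (generator \<epsilon> g) (J, \<phi>, p, x)"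
proof -
  let ?z = "(J, \<phi>, p, x)"
  define \<zeta> where "\<zeta> = (J, saw \<phi>, p, \<epsilon> * x)"
  define H where "H i j = D i (D j g) \<zeta>" for i j
  have \<zeta>: "\<zeta> \<in> phase_box m" "0 < fst \<zeta>" "0 < J"
    using mixed_point_in_box[OF mem(1,2)] box_positive_action[OF \<open>0 < m\<close>] unfolding \<zeta>_def by force+
  have H: "\<bar>H i j\<bar> \<le> L" if "i \<in> axes" "j \<in> axes" for i j
    using bounds \<zeta>(1) that unfolding derivatives_bounded_def H_def by blast
  have sym: "H i j = H j i" for i j
    unfolding H_def by (rule D_commute[OF g \<zeta>(2)])
  \<comment> \<open>The differential of \<open>\<partial>g/\<partial>w\<close>, read as a function of the mixed variables.\<close>
  define h where "h w v = (case v of (a, b, c, e) \<Rightarrow>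
    a * H e_action w + b * H e_angle w + c * H e_momentum w + \<epsilon> * e * H e_coord w)" for w v
  have point: "((\<lambda>(J, \<phi>, p, x). (J, saw \<phi>, p, \<epsilon> * x)) has_derivative
      (\<lambda>(a, b, c, e). (a, b, c, \<epsilon> * e))) (at ?z)"
  proof -
    have 1: "((\<lambda>z. fst (snd z)) has_derivative (\<lambda>v. fst (snd v))) (at ?z)"
      by (intro derivative_intros)
    have 2: "(saw has_derivative (\<lambda>v. v)) (at (fst (snd ?z)))"
      using has_field_derivative_imp_has_derivative[OF DERIV_saw[OF mem(3)]]
      by (simp add: mult_1_left[abs_def])
    have "((\<lambda>z. (fst z, saw (fst (snd z)), fst (snd (snd z)), \<epsilon> * snd (snd (snd z)))) has_derivative
        (\<lambda>v. (fst v, fst (snd v), fst (snd (snd v)), \<epsilon> * snd (snd (snd v))))) (at ?z)"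
      by (intro derivative_intros has_derivative_compose[OF 1 2])
    then show ?thesis
      by (simp add: case_prod_beta')
  qed
  have h: "((\<lambda>(J, \<phi>, p, x). D w g (J, saw \<phi>, p, \<epsilon> * x)) has_derivative h w) (at ?z)" for w
  proof -
    have "(D w g has_derivative (\<lambda>v. D v (D w g) \<zeta>))
        (at ((\<lambda>(J, \<phi>, p, x). (J, saw \<phi>, p, \<epsilon> * x)) ?z))"
      using coeffs_has_derivative[OF D_coeffs[OF g] \<zeta>(2)] by (simp add: \<zeta>_def)
    note comp = has_derivative_compose[OF point this]
    have "D (case v of (a, b, c, e) \<Rightarrow> (a, b, c, \<epsilon> * e)) (D w g) \<zeta> = h w v" for v
      by (cases v) (simp only: prod.case h_def H_def, rule D_linear[OF D_coeffs[OF g] \<zeta>(2)])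
    with comp show ?thesis
      by (simp only: case_prod_beta' fst_conv snd_conv)
  qed
  note h' = h[unfolded case_prod_beta']
  have "open ({0<..} \<times> regular_angles \<times> UNIV :: phase set)"
    by (intro open_Times open_regular_angles) auto
  note local_eq = has_derivative_transform_within_open[OF _ this]
  define A where "A v = (fst v + \<epsilon> * h e_angle v, fst (snd v),
    fst (snd (snd v)) + \<epsilon>\<^sup>2 * h e_coord v, snd (snd (snd v)))" for v :: phase
  define B where "B v = (fst v, fst (snd v) + \<epsilon> * h e_action v,
    fst (snd (snd v)), snd (snd (snd v)) + \<epsilon> * h e_momentum v)" for v :: phase
  have A: "(old_map (generator \<epsilon> g) has_derivative A) (at ?z)"
  proof (rule local_eq)
    show "((\<lambda>z. (fst z + \<epsilon> * (\<lambda>(J, \<phi>, p, x). D e_angle g (J, saw \<phi>, p, \<epsilon> * x)) z, fst (snd z),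
        fst (snd (snd z)) + \<epsilon>\<^sup>2 * (\<lambda>(J, \<phi>, p, x). D e_coord g (J, saw \<phi>, p, \<epsilon> * x)) z,
        snd (snd (snd z)))) has_derivative A) (at ?z)"
      unfolding A_def[abs_def] by (intro derivative_intros h)
  qed (use \<zeta>(3) mem old_map_generator[OF g] in auto)
  have B: "(new_map (generator \<epsilon> g) has_derivative B) (at ?z)"
  proof (rule local_eq)
    show "((\<lambda>z. (fst z, fst (snd z) + \<epsilon> * (\<lambda>(J, \<phi>, p, x). D e_action g (J, saw \<phi>, p, \<epsilon> * x)) z,
        fst (snd (snd z)),
        snd (snd (snd z)) + \<epsilon> * (\<lambda>(J, \<phi>, p, x). D e_momentum g (J, saw \<phi>, p, \<epsilon> * x)) z))
        has_derivative B) (at ?z)"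
      unfolding B_def[abs_def] by (intro derivative_intros h)
  qed (use \<zeta>(3) mem new_map_generator[OF g] in auto)
  \<comment> \<open>A common bound for the perturbing terms in the equations \<open>A v = 0\<close> and \<open>B v = 0\<close>.\<close>
  have small: "\<bar>a\<bar> \<le> \<epsilon> * L * (\<bar>b\<bar> + \<bar>c\<bar>)"
    if "a + \<delta> * (b * u + c * w) = 0" "0 \<le> \<delta>" "\<delta> \<le> \<epsilon>" "\<bar>u\<bar> \<le> L" "\<bar>w\<bar> \<le> L"
    for a b c u w \<delta> :: real
  proof -
    have "\<bar>b * u + c * w\<bar> \<le> \<bar>b\<bar> * \<bar>u\<bar> + \<bar>c\<bar> * \<bar>w\<bar>"
      unfolding abs_mult[symmetric] by (rule abs_triangle_ineq)
    also have "\<dots> \<le> \<bar>b\<bar> * L + \<bar>c\<bar> * L"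
      using that by (intro add_mono mult_left_mono) auto
    also have "\<dots> = L * (\<bar>b\<bar> + \<bar>c\<bar>)"
      by (simp add: algebra_simps)
    finally have "\<delta> * \<bar>b * u + c * w\<bar> \<le> \<epsilon> * (L * (\<bar>b\<bar> + \<bar>c\<bar>))"
      using that \<epsilon> by (intro mult_mono) auto
    moreover have "\<bar>a\<bar> = \<delta> * \<bar>b * u + c * w\<bar>"
    proof -
      have "a = - (\<delta> * (b * u + c * w))" using that(1) by linarith
      then show ?thesis using that(2) by (simp add: abs_mult)
    qed
    ultimately show ?thesis by (simp only: mult.assoc)
  qed
  have k: "4 * (\<epsilon> * L) \<le> 1" "\<epsilon>\<^sup>2 \<le> \<epsilon>" "\<epsilon> * \<epsilon> \<le> \<epsilon>"
    using \<epsilon> by (auto simp: power2_eq_square mult_left_le)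
  have "bij A"
  proof (rule bij_if_trivial_kernel[OF has_derivative_linear[OF A]])
    fix v assume v: "A v = 0"
    obtain a b c e where abce: "v = (a, b, c, e)" by (cases v)
    have be: "b = 0" "e = 0"
      and eqs: "a + \<epsilon> * (a * H e_action e_angle + c * H e_momentum e_angle) = 0"
        "c + \<epsilon>\<^sup>2 * (a * H e_action e_coord + c * H e_momentum e_coord) = 0"
      using v by (auto simp: abce A_def h_def zero_prod_def)
    have "a = 0 \<and> c = 0"
    proof (rule small_coupling_imp_zero[OF _ _ k(1)])
      show "\<bar>a\<bar> \<le> \<epsilon> * L * (\<bar>a\<bar> + \<bar>c\<bar>)"
        by (rule small[OF eqs(1) _ _ H H]) (use \<epsilon> in simp_all)
      show "\<bar>c\<bar> \<le> \<epsilon> * L * (\<bar>a\<bar> + \<bar>c\<bar>)"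
        by (rule small[OF eqs(2) _ k(2) H H]) simp_all
    qed
    then show "v = 0"
      by (simp add: abce be zero_prod_def)
  qed
  moreover have "bij B"
  proof (rule bij_if_trivial_kernel[OF has_derivative_linear[OF B]])
    fix v assume v: "B v = 0"
    obtain a b c e where abce: "v = (a, b, c, e)" by (cases v)
    have ac: "a = 0" "c = 0"
      and eqs: "b + \<epsilon> * (b * H e_angle e_action + e * (\<epsilon> * H e_coord e_action)) = 0"
        "e + \<epsilon> * (b * H e_angle e_momentum + e * (\<epsilon> * H e_coord e_momentum)) = 0"
      using v by (auto simp: abce B_def h_def zero_prod_def mult_ac)
    have \<epsilon>H: "\<bar>\<epsilon> * H i j\<bar> \<le> L" if "i \<in> axes" "j \<in> axes" for i j
    proof -
      have "\<bar>\<epsilon> * H i j\<bar> \<le> 1 * \<bar>H i j\<bar>"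
        unfolding abs_mult using \<epsilon> by (intro mult_right_mono) auto
      then show ?thesis using H[OF that] by simp
    qed
    have "b = 0 \<and> e = 0"
    proof (rule small_coupling_imp_zero[OF _ _ k(1)])
      show "\<bar>b\<bar> \<le> \<epsilon> * L * (\<bar>b\<bar> + \<bar>e\<bar>)"
        by (rule small[OF eqs(1) _ _ H \<epsilon>H]) (use \<epsilon> in simp_all)
      show "\<bar>e\<bar> \<le> \<epsilon> * L * (\<bar>b\<bar> + \<bar>e\<bar>)"
        by (rule small[OF eqs(2) _ _ H \<epsilon>H]) (use \<epsilon> in simp_all)
    qed
    then show "v = 0"
      by (simp add: abce ac zero_prod_def)
  qed
  moreover have "symp (A u) (A v) = symp (B u) (B v)" for u v
  proof -
    obtain a b c e a' b' c' e' where uv: "u = (a, b, c, e)" "v = (a', b', c', e')"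
      by (cases u, cases v)
    show ?thesis
      unfolding uv symp_def A_def B_def h_def
      by (simp add: sym[of e_angle e_action] sym[of e_momentum e_action] sym[of e_coord e_action]
          sym[of e_momentum e_angle] sym[of e_coord e_angle] sym[of e_coord e_momentum]
          power2_eq_square algebra_simps)
  qed
  ultimately show ?thesis
    unfolding canonical_at_def using A B by blast
qed

end

section \<open>Uniformity over compact sets of actions and bounded sets of momenta\<close>

lemma of_order_abs: "of_order N F \<Longrightarrow> of_order N (\<lambda>\<epsilon> z. \<bar>F \<epsilon> z\<bar>)"
  by (simp add: of_order_def)

lemma compact_bounded_in_box:
  fixes K B :: "real set"
  assumes "compact K" "K \<subseteq> {0<..}" "bounded B"
  obtains m where "0 < m" "K \<subseteq> {inverse m..m}" "B \<subseteq> {-m..m}"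
proof -
  obtain k where k: "0 < k" "\<And>J. J \<in> K \<Longrightarrow> k \<le> J"
  proof (cases "K = {}")
    case False
    then obtain k where "k \<in> K" "\<forall>J\<in>K. k \<le> J"
      using compact_attains_inf[OF assms(1)] by blast
    then show ?thesis using assms(2) by (intro that[of k]) auto
  qed (use that[of 1] in simp)
  obtain b where b: "0 < b" "\<And>J. J \<in> K \<Longrightarrow> \<bar>J\<bar> \<le> b"
    using compact_imp_bounded[OF assms(1)] unfolding bounded_pos by auto
  obtain c where c: "0 < c" "\<And>p. p \<in> B \<Longrightarrow> \<bar>p\<bar> \<le> c"
    using assms(3) unfolding bounded_pos by auto
  define m where "m = inverse k + b + c"
  have ik: "0 < inverse k"
    using k(1) by simp
  have m: "0 < m" "inverse k \<le> m" "b \<le> m" "c \<le> m"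
    using ik b(1) c(1) unfolding m_def by linarith+
  have "inverse m \<le> k"
    using le_imp_inverse_le[OF m(2) ik] by simp
  then have "K \<subseteq> {inverse m..m}"
    using k(2) b(2) m(3) by (meson abs_le_D1 atLeastAtMost_iff order_trans subsetI)
  moreover have "p \<in> {-m..m}" if "p \<in> B" for p
    using c(2)[OF that] m(4) by (simp add: abs_le_iff)
  ultimately show ?thesis
    using that m(1) by blast
qed

context waveguide
begin

lemma of_order_D2_epoly:
  assumes "\<And>i. c i \<in> coeffs"
  shows "of_order 0 (\<lambda>\<epsilon>. D v (D w (epoly c n \<epsilon>)))"
proof (rule of_order_cong)
  show "of_order 0 (epoly (\<lambda>i. D v (D w (c i))) n)"
    by (rule expands_imp_of_order[OF expands_epoly[of _ 0]]) (intro D_coeffs assms)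
  fix \<epsilon> J s p X assume J: "0 < (J::real)"
  have "D v (D w (epoly c n \<epsilon>)) (J, s, p, X) = D v (epoly (\<lambda>i. D w (c i)) n \<epsilon>) (J, s, p, X)"
    by (rule D_cong) (simp_all add: D_epoly assms J)
  then show "D v (D w (epoly c n \<epsilon>)) (J, s, p, X) = epoly (\<lambda>i. D v (D w (c i))) n \<epsilon> (J, s, p, X)"
    by (simp add: D_epoly D_coeffs assms J)
qed

text \<open>Finitely many derivatives are of order 0, so the sum of their absolute values provides one bound
  and one range of \<open>\<epsilon>\<close> for all of them.\<close>

lemma eventually_derivatives_bounded:
  assumes c: "\<And>i. c i \<in> coeffs" and "0 < m"
  obtains L where "0 < L" "\<forall>\<^sub>F \<epsilon> in at_right 0. derivatives_bounded (epoly c n \<epsilon>) m L"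
proof -
  let ?g = "epoly c n"
  let ?F = "\<lambda>\<epsilon> z. \<Sum>v\<in>axes. \<bar>D v (?g \<epsilon>) z\<bar> + (\<Sum>w\<in>axes. \<bar>D v (D w (?g \<epsilon>)) z\<bar>)"
  have "of_order 0 ?F"
    by (intro of_order_sum of_order_add of_order_abs of_order_D2_epoly c
        expands_imp_of_order[OF expands_D_epoly[of _ 0]])
  then obtain L where L: "0 < L" "\<forall>\<^sub>F \<epsilon> in at_right 0. \<forall>z\<in>phase_box m. \<bar>?F \<epsilon> z\<bar> \<le> L * \<epsilon> ^ 0"
    using of_orderE \<open>0 < m\<close> by blast
  have summand: "\<bar>D v u z\<bar> \<le> \<bar>G\<bar> \<and> (\<forall>w\<in>axes. \<bar>D v (D w u) z\<bar> \<le> \<bar>G\<bar>)"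
    if v: "v \<in> axes" and G: "G = (\<Sum>v\<in>axes. \<bar>D v u z\<bar> + (\<Sum>w\<in>axes. \<bar>D v (D w u) z\<bar>))" for u z v G
  proof -
    have le: "\<bar>D v u z\<bar> + (\<Sum>w\<in>axes. \<bar>D v (D w u) z\<bar>) \<le> G"
      unfolding G by (rule member_le_sum[OF v]) (auto intro!: add_nonneg_nonneg sum_nonneg)
    have "0 \<le> (\<Sum>w\<in>axes. \<bar>D v (D w u) z\<bar>)"
      by (intro sum_nonneg) simp
    then have "\<bar>D v u z\<bar> \<le> \<bar>G\<bar>"
      using le by linarith
    moreover have "\<bar>D v (D w u) z\<bar> \<le> \<bar>G\<bar>" if "w \<in> axes" for w
    proof -
      have "\<bar>D v (D w u) z\<bar> \<le> (\<Sum>w\<in>axes. \<bar>D v (D w u) z\<bar>)"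
        by (rule member_le_sum[OF that]) auto
      then show ?thesis
        using le by linarith
    qed
    ultimately show ?thesis
      by blast
  qed
  have "\<forall>\<^sub>F \<epsilon> in at_right 0. derivatives_bounded (?g \<epsilon>) m L"
    using L(2)
  proof eventually_elim
    case (elim \<epsilon>)
    have "\<bar>D v (?g \<epsilon>) z\<bar> \<le> L \<and> (\<forall>w\<in>axes. \<bar>D v (D w (?g \<epsilon>)) z\<bar> \<le> L)"
      if "v \<in> axes" "z \<in> phase_box m" for v z
    proof -
      have "\<bar>?F \<epsilon> z\<bar> \<le> L"
        using elim that(2) by simp
      then show ?thesis
        using summand[OF that(1) refl, of "?g \<epsilon>" z] by (meson order_trans)
    qed
    then show ?case
      unfolding derivatives_bounded_def by blast
  qed
  then show ?thesis
    using that L(1) by blast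
qed

lemma canonical_change_on_generator:
  assumes g: "g \<in> coeffs" "angle_periodic g" and "0 < m"
    and bounds: "derivatives_bounded g m L"
    and \<epsilon>: "0 < \<epsilon>" "\<epsilon> \<le> 1" "8 * (\<epsilon> * L) \<le> 1" "0 \<le> L" "\<epsilon> * L < inverse m"
    and KB: "K \<subseteq> {inverse m..m}" "B \<subseteq> {-m..m}"
  shows "canonical_change_on (generator \<epsilon> g) K B"
  unfolding canonical_change_on_def
proof (intro conjI ballI)
  show "bij_betw (new_map (generator \<epsilon> g)) (K \<times> UNIV \<times> B \<times> UNIV) (K \<times> UNIV \<times> B \<times> UNIV)"
    by (rule new_map_generator_bij[OF g \<open>0 < m\<close> bounds \<epsilon>(1-4) KB])
  show "inj_on (old_map (generator \<epsilon> g)) (K \<times> regular_angles \<times> B \<times> UNIV)"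
    by (rule old_map_generator_inj[OF g(1) \<open>0 < m\<close> bounds \<epsilon>(1-4) KB])
  fix z :: phase assume "z \<in> K \<times> regular_angles \<times> B \<times> UNIV"
  then obtain J \<phi> p x where z: "z = (J, \<phi>, p, x)" "J \<in> K" "\<phi> \<in> regular_angles" "p \<in> B"
    by (cases z) auto
  note mem = subsetD[OF KB(1) z(2)] subsetD[OF KB(2) z(4)]
  show "canonical_at (generator \<epsilon> g) z"
    unfolding z(1) by (rule canonical_at_generator[OF g(1) \<open>0 < m\<close> bounds \<epsilon>(1-4) mem z(3)])
  let ?\<zeta> = "(J, saw \<phi>, p, \<epsilon> * x)"
  have box: "?\<zeta> \<in> phase_box m"
    by (rule mixed_point_in_box[OF mem])
  have "0 < J"
    using box_positive_action[OF \<open>0 < m\<close> box] by simp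
  have "\<bar>D e_angle g ?\<zeta>\<bar> \<le> L"
    using bounds box unfolding derivatives_bounded_def by blast
  then have "\<bar>\<epsilon> * D e_angle g ?\<zeta>\<bar> \<le> \<epsilon> * L"
    using \<epsilon>(1) by (simp add: abs_mult)
  also have "\<dots> < J"
    using \<epsilon>(5) mem(1) by simp
  finally have "\<bar>\<epsilon> * D e_angle g ?\<zeta>\<bar> < J" .
  then show "0 < fst (old_map (generator \<epsilon> g) z)"
    unfolding z(1) old_map_generator[OF g(1) \<open>0 < J\<close> z(3)] by simp
qed

lemma ham_old_map_generator:
  assumes "g \<in> coeffs" "0 < J" "\<phi> \<in> regular_angles"
  shows "ham d \<epsilon> (old_map (generator \<epsilon> g) (J, \<phi>, p, x)) = mixed_ham d \<epsilon> g (J, saw \<phi>, p, \<epsilon> * x)"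
  unfolding old_map_generator[OF assms] by (simp add: ham_def mixed_ham_def Let_def)

lemma avg_ham_new_map_generator:
  assumes "g \<in> coeffs" "0 < J" and h: "\<And>i. angle_free (h i)" "h 0 = unperturbed" and "1 \<le> r"
  shows "avg_ham d (\<lambda>i J p X. h i (J, 0, p, X)) r \<epsilon> (new_map (generator \<epsilon> g) (J, \<phi>, p, x)) =
    shift (epoly h r \<epsilon>) (\<epsilon>\<^sup>2 * D e_momentum g (J, saw \<phi>, p, \<epsilon> * x)) (J, saw \<phi>, p, \<epsilon> * x)"
proof -
  let ?b = "D e_momentum g (J, saw \<phi>, p, \<epsilon> * x)"
  have X: "\<epsilon> * (x + \<epsilon> * ?b) = \<epsilon> * x + \<epsilon>\<^sup>2 * ?b"
    by (simp add: power2_eq_square algebra_simps)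
  have free: "h i (J, 0, p, X) = h i (J, saw \<phi>, p, X)" for i X
    using h(1)[of i] \<open>0 < J\<close> unfolding angle_free_def by blast
  have "{..<r} = insert 0 {1..r - 1}"
    using \<open>1 \<le> r\<close> by auto
  then show ?thesis
    unfolding new_map_generator[OF assms(1,2)]
    by (simp add: avg_ham_def Let_def X shift_def epoly_def h(2) free)
qed

lemma angle_dependence_continuous:
  assumes u: "u \<in> coeffs" "angle_periodic u" and "0 < J"
  shows "continuous_on UNIV (\<lambda>\<phi>. u (J, saw \<phi>, p, X))"
proof -
  obtain m where m: "0 < m" "{J} \<subseteq> {inverse m..m}" "{p} \<subseteq> {-m..m}"
    using compact_bounded_in_box[of "{J}" "{p}"] \<open>0 < J\<close> by auto
  obtain L where L: "0 < L" "\<forall>\<^sub>F \<epsilon> in at_right 0. derivatives_bounded (epoly (\<lambda>i. u) 1 \<epsilon>) m L"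
    using eventually_derivatives_bounded[of "\<lambda>i. u", OF u(1) m(1)] by blast
  have "epoly (\<lambda>i. u) 1 \<epsilon> = u" for \<epsilon>
    by (simp add: epoly_def fun_eq_iff)
  with L(2) have "derivatives_bounded u m L"
    by simp
  then have "\<bar>D v u z\<bar> \<le> L" if "v \<in> axes" "z \<in> phase_box m" for v z
    using that unfolding derivatives_bounded_def by blast
  from coeffs_saw_lipschitz[OF u m(1) this, of J p _ X _ X] m(2,3) L(1)
  have "L-lipschitz_on UNIV (\<lambda>\<phi>. u (J, saw \<phi>, p, X))"
    by (intro lipschitz_onI) (auto simp: dist_real_def)
  then show ?thesis
    by (rule lipschitz_on_continuous_on)
qed

lemma angle_dependence_differentiable:
  assumes "u \<in> coeffs" "0 < J" "\<phi> \<in> regular_angles"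
  shows "(\<lambda>\<phi>. u (J, saw \<phi>, p, X)) field_differentiable (at \<phi>)"
  unfolding field_differentiable_def
  using DERIV_chain2[OF coeffs_partial(2)[OF assms(1,2)] DERIV_saw[OF assms(3)]] by blast

end

text \<open>This undoes the index shift between \<^const>\<open>gen_sum\<close>, which starts at 1, and \<^const>\<open>epoly\<close>.\<close>

lemma gen_W_eq_generator:
  "gen_W (\<lambda>i J \<phi> p X. c (i - 1) (J, saw \<phi>, p, X)) r \<epsilon> = generator \<epsilon> (epoly c (r - 1) \<epsilon>)"
proof -
  have reindex: "(\<Sum>i = 1..r - 1. \<epsilon> ^ (i - 1) * f (i - 1)) = (\<Sum>i<r - 1. \<epsilon> ^ i * f i)"
    for f :: "nat \<Rightarrow> real"
    by (rule sum.reindex_bij_witness[of _ Suc "\<lambda>i. i - 1"]) auto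
  show ?thesis
    by (intro ext) (simp only: gen_W_def generator_def gen_sum_def epoly_def
        reindex[of "\<lambda>i. c i (J, saw \<phi>, p, \<epsilon> * x)" for J \<phi> p x])
qed

theorem theorem2:
  fixes d :: "real \<Rightarrow> real" and r :: nat
  assumes "admissible_profile d" and "1 \<le> r"
  shows "\<exists>(S :: nat \<Rightarrow> real \<Rightarrow> real \<Rightarrow> real \<Rightarrow> real \<Rightarrow> real)
          (h :: nat \<Rightarrow> real \<Rightarrow> real \<Rightarrow> real \<Rightarrow> real)
          (R :: real \<Rightarrow> real \<Rightarrow> real \<Rightarrow> real \<Rightarrow> real \<Rightarrow> real).
    (\<forall>i \<in> {1..r - 1}.
       (\<forall>\<phi>. smooth_on ({0<..} \<times> UNIV \<times> UNIV) (\<lambda>(J, p, X). S i J \<phi> p X)) \<and>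
       (\<forall>J p X. 0 < J \<longrightarrow>
          continuous_on UNIV (\<lambda>\<phi>. S i J \<phi> p X) \<and>
          (\<forall>\<phi>. S i J (\<phi> + 2 * pi) p X = S i J \<phi> p X) \<and>
          (\<forall>\<phi> \<in> regular_angles. (\<lambda>\<phi>. S i J \<phi> p X) field_differentiable (at \<phi>))) \<and>
       smooth_on ({0<..} \<times> UNIV \<times> UNIV) (\<lambda>(J, p, X). h i J p X)) \<and>
    (\<forall>K B. compact K \<and> K \<subseteq> {0<..} \<and> bounded B \<longrightarrow>
       (\<exists>\<epsilon>\<^sub>0 > 0. \<exists>C. \<forall>\<epsilon>. 0 < \<epsilon> \<and> \<epsilon> < \<epsilon>\<^sub>0 \<longrightarrow>
          canonical_change_on (gen_W S r \<epsilon>) K B \<and>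
          (\<forall>J \<in> K. \<forall>\<phi> \<in> regular_angles. \<forall>p \<in> B. \<forall>x.
             ham d \<epsilon> (old_map (gen_W S r \<epsilon>) (J, \<phi>, p, x)) =
               avg_ham d h r \<epsilon> (new_map (gen_W S r \<epsilon>) (J, \<phi>, p, x)) + \<epsilon> ^ r * R J \<phi> p (\<epsilon> * x) \<epsilon> \<and>
             \<bar>R J \<phi> p (\<epsilon> * x) \<epsilon>\<bar> \<le> C)))"
proof -
  interpret waveguide d
    by standard (rule assms(1))
  define n where "n = r - 1"
  have r: "r = Suc n"
    using assms(2) by (simp add: n_def)
  obtain c h where c: "\<And>i. c i \<in> coeffs" "\<And>i. angle_periodic (c i)"
    and h: "\<And>i. h i \<in> coeffs" "\<And>i. angle_free (h i)" "h 0 = unperturbed"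
    and small: "of_order r (\<lambda>\<epsilon>. defect d \<epsilon> (epoly c n \<epsilon>) (epoly h r \<epsilon>))"
    using normal_form[of n] unfolding r by blast
  define S where "S = (\<lambda>i J \<phi> p X. c (i - 1) (J, saw \<phi>, p, X))"
  define H where "H = (\<lambda>i J p X. h i (J, 0, p, X))"
  define R where "R = (\<lambda>J \<phi> p X \<epsilon>. defect d \<epsilon> (epoly c n \<epsilon>) (epoly h r \<epsilon>) (J, saw \<phi>, p, X) / \<epsilon> ^ r)"
  have W: "gen_W S r \<epsilon> = generator \<epsilon> (epoly c n \<epsilon>)" for \<epsilon>
    unfolding S_def n_def by (rule gen_W_eq_generator)
  have g: "epoly c n \<epsilon> \<in> coeffs" "angle_periodic (epoly c n \<epsilon>)" for \<epsilon>
    using c by (auto intro: epoly_coeffs simp: angle_periodic_def epoly_def)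
  have regularity: "(\<forall>\<phi>. smooth_on ({0<..} \<times> UNIV \<times> UNIV) (\<lambda>(J, p, X). S i J \<phi> p X)) \<and>
       (\<forall>J p X. 0 < J \<longrightarrow>
          continuous_on UNIV (\<lambda>\<phi>. S i J \<phi> p X) \<and>
          (\<forall>\<phi>. S i J (\<phi> + 2 * pi) p X = S i J \<phi> p X) \<and>
          (\<forall>\<phi> \<in> regular_angles. (\<lambda>\<phi>. S i J \<phi> p X) field_differentiable (at \<phi>))) \<and>
       smooth_on ({0<..} \<times> UNIV \<times> UNIV) (\<lambda>(J, p, X). H i J p X)" for i
    unfolding S_def H_def saw_periodic
    by (intro conjI allI impI ballI coeffs_smooth_on[OF c(1)] coeffs_smooth_on[OF h(1)]
        angle_dependence_continuous[OF c] angle_dependence_differentiable[OF c(1)] refl)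
  have change: "\<exists>\<epsilon>\<^sub>0 > 0. \<exists>C. \<forall>\<epsilon>. 0 < \<epsilon> \<and> \<epsilon> < \<epsilon>\<^sub>0 \<longrightarrow>
      canonical_change_on (gen_W S r \<epsilon>) K B \<and>
      (\<forall>J \<in> K. \<forall>\<phi> \<in> regular_angles. \<forall>p \<in> B. \<forall>x.
         ham d \<epsilon> (old_map (gen_W S r \<epsilon>) (J, \<phi>, p, x)) =
           avg_ham d H r \<epsilon> (new_map (gen_W S r \<epsilon>) (J, \<phi>, p, x)) + \<epsilon> ^ r * R J \<phi> p (\<epsilon> * x) \<epsilon> \<and>
         \<bar>R J \<phi> p (\<epsilon> * x) \<epsilon>\<bar> \<le> C)"
    if KB0: "compact K" "K \<subseteq> {0<..}" "bounded B" for K B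
  proof -
    obtain m where m: "0 < m" and KB: "K \<subseteq> {inverse m..m}" "B \<subseteq> {-m..m}"
      using compact_bounded_in_box[OF KB0] by blast
    obtain L where L: "0 < L" "\<forall>\<^sub>F \<epsilon> in at_right 0. derivatives_bounded (epoly c n \<epsilon>) m L"
      by (rule eventually_derivatives_bounded[OF c(1) m])
    obtain C where C: "\<forall>\<^sub>F \<epsilon> in at_right 0. \<forall>z\<in>phase_box m.
        \<bar>defect d \<epsilon> (epoly c n \<epsilon>) (epoly h r \<epsilon>) z\<bar> \<le> C * \<epsilon> ^ r"
      by (rule of_orderE[OF small m])
    have below: "\<forall>\<^sub>F \<epsilon> in at_right 0. \<epsilon> < b" if "0 < b" for b :: real
      using that by (auto simp: eventually_at_right_field)
    have pos: "0 < 1 / (8 * L)" "0 < inverse m / L"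
      using L(1) m by simp_all
    have "\<forall>\<^sub>F \<epsilon> in at_right 0. canonical_change_on (gen_W S r \<epsilon>) K B \<and>
      (\<forall>J \<in> K. \<forall>\<phi> \<in> regular_angles. \<forall>p \<in> B. \<forall>x.
         ham d \<epsilon> (old_map (gen_W S r \<epsilon>) (J, \<phi>, p, x)) =
           avg_ham d H r \<epsilon> (new_map (gen_W S r \<epsilon>) (J, \<phi>, p, x)) + \<epsilon> ^ r * R J \<phi> p (\<epsilon> * x) \<epsilon> \<and>
         \<bar>R J \<phi> p (\<epsilon> * x) \<epsilon>\<bar> \<le> C)"
      using L(2) C eventually_at_right_less[of 0] below[OF zero_less_one] below[OF pos(1)] below[OF pos(2)]
    proof eventually_elim
      case (elim \<epsilon>)
      have \<epsilon>: "0 < \<epsilon>" "\<epsilon> \<le> 1" "8 * (\<epsilon> * L) \<le> 1" "0 \<le> L" "\<epsilon> * L < inverse m"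
        using elim L(1) m by (auto simp: field_simps)
      have "canonical_change_on (gen_W S r \<epsilon>) K B"
        unfolding W by (rule canonical_change_on_generator[OF g m elim(1) \<epsilon> KB])
      moreover have "ham d \<epsilon> (old_map (gen_W S r \<epsilon>) (J, \<phi>, p, x)) =
           avg_ham d H r \<epsilon> (new_map (gen_W S r \<epsilon>) (J, \<phi>, p, x)) + \<epsilon> ^ r * R J \<phi> p (\<epsilon> * x) \<epsilon> \<and>
         \<bar>R J \<phi> p (\<epsilon> * x) \<epsilon>\<bar> \<le> C"
        if J: "J \<in> K" "\<phi> \<in> regular_angles" "p \<in> B" for J \<phi> p x
      proof
        have box: "(J, saw \<phi>, p, \<epsilon> * x) \<in> phase_box m"
          by (rule mixed_point_in_box[OF subsetD[OF KB(1) J(1)] subsetD[OF KB(2) J(3)]])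
        have "0 < J"
          using J(1) KB0(2) by auto
        show "ham d \<epsilon> (old_map (gen_W S r \<epsilon>) (J, \<phi>, p, x)) =
           avg_ham d H r \<epsilon> (new_map (gen_W S r \<epsilon>) (J, \<phi>, p, x)) + \<epsilon> ^ r * R J \<phi> p (\<epsilon> * x) \<epsilon>"
          unfolding W H_def ham_old_map_generator[OF g(1) \<open>0 < J\<close> J(2)]
            avg_ham_new_map_generator[where h = h, OF g(1) \<open>0 < J\<close> h(2,3) assms(2)]
          using \<epsilon>(1) by (simp add: R_def defect_def)
        have "\<bar>defect d \<epsilon> (epoly c n \<epsilon>) (epoly h r \<epsilon>) (J, saw \<phi>, p, \<epsilon> * x)\<bar> \<le> C * \<epsilon> ^ r"
          using elim(2) box by blast
        then show "\<bar>R J \<phi> p (\<epsilon> * x) \<epsilon>\<bar> \<le> C"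
          using \<epsilon>(1) by (simp add: R_def abs_divide pos_divide_le_eq)
      qed
      ultimately show ?case by blast
    qed
    then obtain \<epsilon>\<^sub>0 where "0 < \<epsilon>\<^sub>0" and main: "\<And>\<epsilon>. 0 < \<epsilon> \<Longrightarrow> \<epsilon> < \<epsilon>\<^sub>0 \<Longrightarrow>
      canonical_change_on (gen_W S r \<epsilon>) K B \<and>
      (\<forall>J \<in> K. \<forall>\<phi> \<in> regular_angles. \<forall>p \<in> B. \<forall>x.
         ham d \<epsilon> (old_map (gen_W S r \<epsilon>) (J, \<phi>, p, x)) =
           avg_ham d H r \<epsilon> (new_map (gen_W S r \<epsilon>) (J, \<phi>, p, x)) + \<epsilon> ^ r * R J \<phi> p (\<epsilon> * x) \<epsilon> \<and>
         \<bar>R J \<phi> p (\<epsilon> * x) \<epsilon>\<bar> \<le> C)"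
      unfolding eventually_at_right_field by blast
    show ?thesis
      using \<open>0 < \<epsilon>\<^sub>0\<close> main by blast
  qed
  show ?thesis
    by (rule exI[of _ S], rule exI[of _ H], rule exI[of _ R], intro conjI ballI allI impI)
      (use regularity change in blast)+
qed

end
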